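(* Let $g$ and $k$ be integers with $g \ge 3$ and $k \ge 2$, let $a \ge -1$ be a real number, and let $G$ be a simple graph of order $n$ with minimum degree $\delta \geq 2k \geq 4$ and girth $g$. Let $n_1^* = n_1^*(\delta,g)$. If $\displaystyle \lambda_{2}(G, a)< (a+1)\delta-\frac{2k-1}{n_{1}^{*}}$, then $\tau(G)\geq k$.
   Context: All graphs are finite and simple. $\tau(G)$ denotes the maximum number of edge-disjoint spanning trees contained in $G$. For a graph $G$ with adjacency matrix $A$ and diagonal degree matrix $D$, and a real number $a \ge -1$, $\lambda_i(G,a)$ denotes the $i$th largest eigenvalue (with multiplicity) of $aD+A$. The girth of $G$ is the length of a shortest cycle of $G$ ($\infty$ if $G$ is acyclic). For integers $\delta>0$ and $g\ge 3$, put $t=\lfloor \frac{g-1}{2}\rfloor$ and $$n_1^*=n_1^*(\delta,g)=\begin{cases}1+\delta+\sum_{i=2}^{t}(\delta-1)^{i}, & \text{if } g=2t+1,\\ 2+2(\delta-1)^{t}+\sum_{i=1}^{t-1}(\delta-1)^{i}, & \text{if } g=2t+2,\end{cases}$$ where empty sums are $0$. *)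

theory Defs
  imports
    "Graph_Theory.Graph_Theory"
    "Jordan_Normal_Form.Char_Poly"
    "HOL-Library.Extended_Nat"
    "HOL-Library.Multiset"
begin

text \<open>
  A finite simple graph is a \<open>pair_graph\<close>: finite vertex set and a finite, symmetric, irreflexive
  set of ordered pairs of vertices, so that an undirected edge is a pair of opposite arcs. In this
  representation \<open>out_degree\<close> is the degree and \<open>connected\<close> is connectedness.
  The library's \<open>cycle\<close> also admits the closed walk u, v, u along one edge and its reversal;
  requiring length at least 3 leaves exactly the cycles of the undirected graph. For the same
  reason the library's \<open>tree\<close> and \<open>spanning_tree\<close>, which forbid only directed cycles, cannot be
  used for undirected trees.
\<close>

definition ucycle :: "'a pair_pre_digraph \<Rightarrow> ('a \<times> 'a) list \<Rightarrow> bool" where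
  "ucycle G p \<longleftrightarrow> pre_digraph.cycle (with_proj G) p \<and> 3 \<le> length p"

text \<open>The infimum of the empty set is \<open>\<infinity>\<close>.\<close>

definition girth :: "'a pair_pre_digraph \<Rightarrow> enat" where
  "girth G = (INF p \<in> {p. ucycle G p}. enat (length p))"

definition min_degree :: "'a pair_pre_digraph \<Rightarrow> nat" where
  "min_degree G = Min (out_degree (with_proj G) ` pverts G)"

definition utree :: "'a pair_pre_digraph \<Rightarrow> bool" where
  "utree H \<longleftrightarrow> pair_graph H \<and> Digraph_Component.connected (with_proj H) \<and> (\<nexists>p. ucycle H p)"

definition spanning_utree :: "'a pair_pre_digraph \<Rightarrow> 'a pair_pre_digraph \<Rightarrow> bool" where
  "spanning_utree H G \<longleftrightarrow> utree H \<and> spanning (with_proj H) (with_proj G)"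

text \<open>
  The arc sets of trees are closed under reversal, so disjointness of arc sets is disjointness of
  edge sets.
\<close>

definition tree_packing :: "'a pair_pre_digraph set \<Rightarrow> 'a pair_pre_digraph \<Rightarrow> bool" where
  "tree_packing F G \<longleftrightarrow> finite F \<and> (\<forall>H\<in>F. spanning_utree H G) \<and>
     pairwise (\<lambda>H K. parcs H \<inter> parcs K = {}) F"

definition tau :: "'a pair_pre_digraph \<Rightarrow> nat" where
  "tau G = Max {card F | F. tree_packing F G}"

definition adj_mat :: "'a pair_pre_digraph \<Rightarrow> 'a list \<Rightarrow> real mat" where
  "adj_mat G vs = mat (length vs) (length vs)
     (\<lambda>(i, j). if (vs ! i, vs ! j) \<in> parcs G then 1 else 0)"

definition deg_mat :: "'a pair_pre_digraph \<Rightarrow> 'a list \<Rightarrow> real mat" where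
  "deg_mat G vs = mat (length vs) (length vs)
     (\<lambda>(i, j). if i = j then real (out_degree (with_proj G) (vs ! i)) else 0)"

text \<open>
  An arbitrary enumeration of the vertices; another choice conjugates the matrices above by a
  permutation matrix and so does not change the spectrum.
\<close>

definition vert_list :: "'a pair_pre_digraph \<Rightarrow> 'a list" where
  "vert_list G = (SOME vs. distinct vs \<and> set vs = pverts G)"

definition aDA_mat :: "'a pair_pre_digraph \<Rightarrow> real \<Rightarrow> real mat" where
  "aDA_mat G a = a \<cdot>\<^sub>m deg_mat G (vert_list G) + adj_mat G (vert_list G)"

text \<open>
  The real eigenvalues in decreasing order, repeated according to their multiplicity as roots of
  the characteristic polynomial; for a symmetric real matrix of size n this list has length n.
\<close>

definition eigvals_desc :: "real mat \<Rightarrow> real list" where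
  "eigvals_desc M = rev (sorted_list_of_multiset (proots (char_poly M)))"

definition lambda :: "nat \<Rightarrow> 'a pair_pre_digraph \<Rightarrow> real \<Rightarrow> real" where
  "lambda i G a = eigvals_desc (aDA_mat G a) ! (i - 1)"

definition n1_star :: "nat \<Rightarrow> nat \<Rightarrow> nat" where
  "n1_star \<delta> g = (let t = (g - 1) div 2 in
     if odd g then 1 + \<delta> + (\<Sum>i = 2..t. (\<delta> - 1) ^ i)
     else 2 + 2 * (\<delta> - 1) ^ t + (\<Sum>i = 1..t - 1. (\<delta> - 1) ^ i))"

end

theory Submission
  imports
    Defs
    "Jordan_Normal_Form.Schur_Decomposition"
    "HOL-Computational_Algebra.Fundamental_Theorem_Algebra"
    "HOL-Library.Indicator_Function"
begin

text \<open>
  If there are no \<open>k\<close> edge-disjoint spanning trees, the Nash-Williams--Tutte theorem gives a partition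
  of the vertices into \<open>p\<close> parts with fewer than \<open>k (p - 1)\<close> crossing edges. Averaging over the parts
  yields two of them, \<open>X\<close> and \<open>Y\<close>, with \<open>d(X) + e(X, Y) \<le> 2k - 1\<close> and \<open>d(Y) + e(X, Y) \<le> 2k - 1\<close>,
  where \<open>d\<close> counts boundary edges. As \<open>2k - 1 < \<delta>\<close>, a Moore-type count of the levels around a vertex
  or an edge without boundary edges shows that both parts have at least \<open>n1_star \<delta> g\<close> vertices.
  On the span of the two indicator vectors the quadratic form of \<open>aD + A\<close> is then at least
  \<open>(a + 1) \<delta> - (2k - 1) / n1_star \<delta> g\<close>, which bounds the second eigenvalue from below.
\<close>

section \<open>The second eigenvalue of a real symmetric matrix\<close>

text \<open>A single part with small boundary says nothing about the second eigenvalue: a plane of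
  test vectors is needed, hence two disjoint parts. On \<open>\<alpha> 1_X + \<beta> 1_Y\<close> the
  form of \<open>aD + A\<close> is the sum of \<open>\<alpha>^2 ((a + 1) vol(X) - d(X))\<close>, the
  analogous term for \<open>Y\<close>, and \<open>2 \<alpha> \<beta> e(X, Y)\<close>, where
  \<open>vol\<close> adds up degrees. The mixed term has no fixed sign, so in the worst case each
  part pays for \<open>e(X, Y)\<close> once more. This is why \<open>d + e\<close> has to be bounded
  instead of \<open>d\<close>, and why the two parts are selected jointly. The condition
  \<open>a \<ge> -1\<close> lets the minimum degree bound \<open>(a + 1) vol(X)\<close> from below.
  The partition arises as the components of an edge set \<open>R\<close> attached to a largest
  family of disjoint forests: each forest, restricted to \<open>R\<close>, connects everything that
  \<open>R\<close> connects, and no edge outside \<open>R\<close> is left uncovered, so counting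
  edges in the forests gives the number of crossing edges exactly.\<close>

lemma symmetric_real_eigenvector:
  fixes A :: "real mat"
  assumes A: "A \<in> carrier_mat n n" and sym: "transpose_mat A = A" and n: "n \<noteq> 0"
  obtains v e where "v \<in> carrier_vec n" "v \<noteq> 0\<^sub>v n" "A *\<^sub>v v = e \<cdot>\<^sub>v v"
proof -
  let ?C = "map_mat complex_of_real A"
  have C: "?C \<in> carrier_mat n n" using A by simp
  have "degree (char_poly ?C) = n" using degree_monic_char_poly[OF C] by simp
  then have "\<not> constant (poly (char_poly ?C))" using n by (simp add: constant_degree)
  then obtain z where "poly (char_poly ?C) z = 0" using fundamental_theorem_of_algebra by blast
  then have "eigenvalue ?C z" using eigenvalue_root_char_poly[OF C] by simp
  then obtain v where v: "v \<in> carrier_vec n" "v \<noteq> 0\<^sub>v n" "?C *\<^sub>v v = z \<cdot>\<^sub>v v"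
    using C unfolding eigenvalue_def eigenvector_def by auto
  have ev: "(\<Sum>j<n. of_real (A $$ (i, j)) * v $ j) = z * v $ i" if "i < n" for i
  proof -
    have "(?C *\<^sub>v v) $ i = z * v $ i" using v that by simp
    moreover have "(?C *\<^sub>v v) $ i = (\<Sum>j<n. of_real (A $$ (i, j)) * v $ j)"
      using that A v(1) by (simp add: scalar_prod_def atLeast0LessThan)
    ultimately show ?thesis by simp
  qed
  have symA: "A $$ (i, j) = A $$ (j, i)" if "i < n" "j < n" for i j
    using sym A that by (metis carrier_matD index_transpose_mat(1))
  define N where "N = (\<Sum>i<n. (cmod (v $ i))\<^sup>2)"
  have N: "of_real N = (\<Sum>i<n. cnj (v $ i) * v $ i)"
    unfolding N_def by (simp add: complex_norm_square mult.commute del: of_real_power)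
  \<comment> \<open>This is the Hermitian form of \<open>A\<close> at \<open>v\<close>. As
    \<open>A\<close> is real and symmetric, conjugation only swaps the two summation indices, so the
    value is its own conjugate and \<open>z\<close> is real.\<close>
  have zN: "z * of_real N = (\<Sum>i<n. \<Sum>j<n. of_real (A $$ (i, j)) * v $ j * cnj (v $ i))"
  proof -
    have "z * of_real N = (\<Sum>i<n. cnj (v $ i) * (z * v $ i))"
      unfolding N by (simp add: sum_distrib_left algebra_simps)
    also have "\<dots> = (\<Sum>i<n. cnj (v $ i) * (\<Sum>j<n. of_real (A $$ (i, j)) * v $ j))"
      by (intro sum.cong) (simp_all add: ev)
    finally show ?thesis by (simp add: sum_distrib_left algebra_simps)
  qed
  have "cnj (z * of_real N) = (\<Sum>i<n. \<Sum>j<n. of_real (A $$ (i, j)) * cnj (v $ j) * v $ i)"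
    unfolding zN by simp
  also have "\<dots> = (\<Sum>j<n. \<Sum>i<n. of_real (A $$ (i, j)) * cnj (v $ j) * v $ i)"
    by (rule sum.swap)
  also have "\<dots> = z * of_real N"
    unfolding zN by (intro sum.cong) (simp_all add: symA algebra_simps)
  finally have "cnj z * of_real N = z * of_real N" by simp
  moreover have "N \<noteq> 0"
  proof
    assume "N = 0"
    then have "\<forall>i<n. v $ i = 0" unfolding N_def by (simp add: sum_nonneg_eq_0_iff)
    then have "v = 0\<^sub>v n" using v(1) by (intro eq_vecI) auto
    then show False using v(2) by contradiction
  qed
  ultimately have z: "z = of_real (Re z)" by (metis complex_cnj_cancel_iff mult_right_cancel of_real_eq_0_iff Reals_cnj_iff of_real_Re)
  \<comment> \<open>With \<open>A\<close> and the eigenvalue real, the eigenvector equation splits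
    into its real and imaginary parts; at least one of the two vectors is nonzero.\<close>
  have *: "A *\<^sub>v map_vec f v = Re z \<cdot>\<^sub>v map_vec f v" if f: "f = Re \<or> f = Im" for f
  proof (rule eq_vecI)
    fix i assume "i < dim_vec (Re z \<cdot>\<^sub>v map_vec f v)"
    then have i: "i < n" using v by simp
    have "f (\<Sum>j<n. of_real (A $$ (i, j)) * v $ j) = f (of_real (Re z) * v $ i)"
      using ev[OF i] z by simp
    then have "(\<Sum>j<n. A $$ (i, j) * f (v $ j)) = Re z * f (v $ i)"
      using f by auto
    then show "(A *\<^sub>v map_vec f v) $ i = (Re z \<cdot>\<^sub>v map_vec f v) $ i"
      using i A v(1) by (simp add: scalar_prod_def atLeast0LessThan)
  qed (use A v in auto)
  have "map_vec Re v \<noteq> 0\<^sub>v n \<or> map_vec Im v \<noteq> 0\<^sub>v n"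
  proof (rule ccontr)
    assume "\<not> ?thesis"
    then have "Re (v $ i) = 0" "Im (v $ i) = 0" if "i < n" for i
      using that v(1) by (metis carrier_vecD index_map_vec(1) index_zero_vec(1))+
    then have "v = 0\<^sub>v n" using v(1) by (intro eq_vecI) (auto simp: complex_eq_iff)
    then show False using v(2) by contradiction
  qed
  then show thesis using that * v(1) by (metis map_carrier_vec)
qed

text \<open>Change of basis for the deflation in the spectral theorem. Gram-Schmidt leaves the first
  vector of its input alone, so \<open>v\<close> survives up to the normalising factor
  \<open>c\<close>.\<close>

lemma orthogonal_mat_first_col:
  fixes v :: "real vec"
  assumes v: "v \<in> carrier_vec n" "v \<noteq> 0\<^sub>v n" and n: "n \<noteq> 0"
  obtains W c where "W \<in> carrier_mat n n" "transpose_mat W * W = 1\<^sub>m n" "col W 0 = c \<cdot>\<^sub>v v"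
proof -
  interpret cof_vec_space n "TYPE(real)" .
  define b where "b = basis_completion v"
  define ws where "ws = gram_schmidt n b"
  note bc = basis_completion[OF v, folded b_def]
  from bc(6,7) n obtain vs where b: "b = v # vs" by (cases b) auto
  note gs = gram_schmidt_result[OF bc(2,4,5) ws_def]
  have hd: "hd ws = v" using gram_schmidt_hd[OF v(1), of vs] b ws_def by simp
  have len: "length ws = n" using gs bc(6) by simp
  have carr: "ws ! i \<in> carrier_vec n" if "i < n" for i using gs(3) len that by auto
  define r where "r i = sqrt (ws ! i \<bullet> ws ! i)" for i
  have orth: "ws ! i \<bullet> ws ! j = 0 \<longleftrightarrow> i \<noteq> j" if "i < n" "j < n" for i j
    using corthogonalD[OF gs(2), of i j] that len by simp
  have pos: "0 < ws ! i \<bullet> ws ! i" if "i < n" for i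
    using orth[OF that that] by (simp add: scalar_prod_def less_le sum_nonneg)
  define W where "W = mat n n (\<lambda>(i, j). (ws ! j) $ i / r j)"
  have W: "W \<in> carrier_mat n n" unfolding W_def by simp
  have colW: "col W j = (1 / r j) \<cdot>\<^sub>v ws ! j" if "j < n" for j
    using that carr[OF that] unfolding W_def by (intro eq_vecI) auto
  have "transpose_mat W * W = 1\<^sub>m n"
  proof (rule eq_matI)
    fix i j assume "i < dim_row (1\<^sub>m n)" "j < dim_col (1\<^sub>m n)"
    then have ij: "i < n" "j < n" by auto
    have "(transpose_mat W * W) $$ (i, j) = col W i \<bullet> col W j" using ij W by simp
    also have "\<dots> = (ws ! i \<bullet> ws ! j) / (r i * r j)"
      using ij carr[OF ij(1)] carr[OF ij(2)]
      by (simp add: colW smult_scalar_prod_distrib[of _ n] scalar_prod_smult_distrib[of _ n])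
    also have "\<dots> = 1\<^sub>m n $$ (i, j)"
      using orth[OF ij] pos[OF ij(1)] ij unfolding r_def by auto
    finally show "(transpose_mat W * W) $$ (i, j) = 1\<^sub>m n $$ (i, j)" .
  qed (use W in auto)
  moreover have "col W 0 = (1 / r 0) \<cdot>\<^sub>v v" using colW n hd len by (metis gr0I hd_conv_nth length_0_conv)
  ultimately show thesis using that W by blast
qed

text \<open>Deflation: in an orthonormal basis that starts with an eigenvector, the first column has
  only its diagonal entry, symmetry clears the first row as well, and the remaining block is
  symmetric and smaller. Using \<open>transpose_mat P\<close> as the inverse in the witness records
  that \<open>P\<close> is orthogonal, which later turns quadratic forms into weighted sums of
  squares.\<close>

theorem real_spectral_theorem:
  fixes A :: "real mat"
  assumes "A \<in> carrier_mat n n" "transpose_mat A = A"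
  shows "\<exists>P D. similar_mat_wit A D P (transpose_mat P) \<and> diagonal_mat D"
  using assms
proof (induction n arbitrary: A)
  case 0
  then have "similar_mat_wit A A (1\<^sub>m 0) (transpose_mat (1\<^sub>m 0))" 
    using similar_mat_wit_refl[of A 0] by simp
  moreover have "diagonal_mat A" using 0 unfolding diagonal_mat_def by auto
  ultimately show ?case by blast
next
  case (Suc m)
  let ?n = "Suc m"
  note A = Suc.prems(1)
  obtain v e where v: "v \<in> carrier_vec ?n" "v \<noteq> 0\<^sub>v ?n" and ev: "A *\<^sub>v v = e \<cdot>\<^sub>v v"
    using symmetric_real_eigenvector[OF A Suc.prems(2)] by auto
  obtain W c where W: "W \<in> carrier_mat ?n ?n" and WW: "transpose_mat W * W = 1\<^sub>m ?n"
    and col0: "col W 0 = c \<cdot>\<^sub>v v"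
    using orthogonal_mat_first_col[OF v] by blast
  let ?T = "transpose_mat W"
  have T: "?T \<in> carrier_mat ?n ?n" using W by simp
  have WW': "W * ?T = 1\<^sub>m ?n" using mat_mult_left_right_inverse[OF T W WW] .
  define B where "B = ?T * (A * W)"
  have B: "B \<in> carrier_mat ?n ?n" using W A T unfolding B_def by auto
  have "W * B * ?T = (W * ?T) * A * (W * ?T)"
    using W A T unfolding B_def by (simp add: assoc_mult_mat[of _ ?n ?n _ ?n _ ?n])
  then have wit: "similar_mat_wit A B W ?T"
    using WW WW' W A T B by (intro similar_mat_witI[of _ _ ?n]) auto
  have symB: "transpose_mat B = B"
    using W A T Suc.prems(2) unfolding B_def
    by (simp add: transpose_mult[of _ ?n ?n _ ?n] assoc_mult_mat[of _ ?n ?n _ ?n _ ?n])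
  have symB': "B $$ (i, j) = B $$ (j, i)" if "i < ?n" "j < ?n" for i j
    using symB B that by (metis carrier_matD index_transpose_mat(1))
  have B0: "B $$ (i, 0) = (if i = 0 then e else 0)" if i: "i < ?n" for i
  proof -
    have "B $$ (i, 0) = col W i \<bullet> col (A * W) 0" using i W A T unfolding B_def by simp
    also have "col (A * W) 0 = A *\<^sub>v col W 0" using W A by (intro col_mult2) auto
    also have "\<dots> = e \<cdot>\<^sub>v col W 0" using mult_mat_vec[OF A v(1)] ev by (simp add: col0 smult_smult_assoc mult.commute)
    also have "col W i \<bullet> \<dots> = e * (?T * W) $$ (i, 0)" using i W by simp
    finally show ?thesis using i unfolding WW by simp
  qed
  define B1 where "B1 = mat m m (\<lambda>(i, j). B $$ (Suc i, Suc j))"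
  define E where "E = mat 1 1 (\<lambda>_. e)"
  have E: "E \<in> carrier_mat 1 1" unfolding E_def by simp
  have B1: "B1 \<in> carrier_mat m m" unfolding B1_def by simp
  have Bblock: "B = four_block_mat E (0\<^sub>m 1 m) (0\<^sub>m m 1) B1"
    using B B0 symB'[of 0] unfolding E_def B1_def
    by (intro eq_matI) (auto simp: less_Suc_eq_0_disj)
  have "transpose_mat B1 = B1" using symB' unfolding B1_def by (intro eq_matI) auto
  then obtain P D where PD: "similar_mat_wit B1 D P (transpose_mat P)" and D: "diagonal_mat D"
    using Suc.IH[OF B1] by blast
  note w = similar_mat_witD2[OF B1 PD]
  let ?P = "four_block_mat (1\<^sub>m 1) (0\<^sub>m 1 m) (0\<^sub>m m 1) P"
  let ?D = "four_block_mat E (0\<^sub>m 1 m) (0\<^sub>m m 1) D"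
  have P: "?P \<in> carrier_mat ?n ?n" using w(6) four_block_carrier_mat[of "1\<^sub>m 1" 1 1 P m m] by simp
  have Pt: "transpose_mat ?P = four_block_mat (1\<^sub>m 1) (0\<^sub>m 1 m) (0\<^sub>m m 1) (transpose_mat P)"
    using w(6) by (subst transpose_four_block_mat[of _ 1 1 _ m _ m]) auto
  have "similar_mat_wit B ?D ?P (transpose_mat ?P)"
    unfolding Pt Bblock
    by (rule similar_mat_wit_four_block[OF similar_mat_wit_refl[OF E] PD _ _ E B1])
      (use w in auto)
  from similar_mat_wit_trans[OF wit this]
  have "similar_mat_wit A ?D (W * ?P) (transpose_mat (W * ?P))"
    using W P by (simp add: transpose_mult)
  moreover have "diagonal_mat ?D"
    using D w(5) unfolding diagonal_mat_def E_def by (auto simp: less_Suc_eq_0_disj) metis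
  ultimately show ?case by blast
qed

section \<open>Sorted eigenvalues and the variational bound\<close>

lemma proots_prod_list_linear: "proots (\<Prod>e\<leftarrow>es. [:- e, 1:]) = mset (es :: 'a :: field list)"
proof (induction es)
  case (Cons e es)
  have "(\<Prod>e\<leftarrow>es. [:- e, 1:]) \<noteq> 0" by (auto simp: prod_list_zero_iff)
  then have "proots ([:- e, 1:] * (\<Prod>e\<leftarrow>es. [:- e, 1:])) = {#e#} + mset es"
    using Cons by (subst proots_mult) auto
  then show ?case by simp
qed simp

text \<open>Translates a statement about the sorted list into one about positions on the diagonal,
  where no order is available: \<open>i\<close> names the one coordinate that a test vector has to
  avoid. It need not be a valid index, since possibly no entry reaches \<open>\<mu>\<close>.\<close>

lemma at_most_one_index_ge:
  fixes \<mu> :: real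
  assumes len: "2 \<le> length es" and less: "rev (sort es) ! 1 < \<mu>"
  obtains i where "\<And>j. j < length es \<Longrightarrow> j \<noteq> i \<Longrightarrow> es ! j < \<mu>"
proof -
  define ds where "ds = rev (sort es)"
  obtain d0 d1 ds' where ds: "ds = d0 # d1 # ds'"
    using len unfolding ds_def by (metis One_nat_def Suc_le_length_iff length_rev length_sort numeral_2_eq_2)
  have "sorted_wrt (\<ge>) ds" unfolding ds_def by (simp add: sorted_wrt_rev)
  then have "\<forall>d\<in>set (d1 # ds'). d < \<mu>" using less unfolding ds_def[symmetric] ds by auto
  then have "filter (\<lambda>d. \<mu> \<le> d) (d1 # ds') = []" by (auto simp: filter_empty_conv)
  then have "length (filter (\<lambda>d. \<mu> \<le> d) ds) \<le> 1" unfolding ds by auto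
  moreover have "length (filter (\<lambda>d. \<mu> \<le> d) ds) = length (filter (\<lambda>d. \<mu> \<le> d) es)"
    unfolding ds_def by (metis mset_filter mset_rev mset_sort size_mset)
  ultimately have "card {i. i < length es \<and> \<mu> \<le> es ! i} \<le> Suc 0"
    by (simp add: length_filter_conv_card)
  then have uniq: "\<forall>i\<in>{i. i < length es \<and> \<mu> \<le> es ! i}. \<forall>j\<in>{i. i < length es \<and> \<mu> \<le> es ! i}. i = j"
    by (subst (asm) card_le_Suc0_iff_eq) auto
  show thesis
  proof (cases "\<exists>i<length es. \<mu> \<le> es ! i")
    case True
    then obtain i where "i < length es" "\<mu> \<le> es ! i" by auto
    then show thesis using uniq by (intro that[of i]) (metis (mono_tags, lifting) mem_Collect_eq not_less)
  next
    case False
    then show thesis by (intro that[of 0]) auto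
  qed
qed

text \<open>One half of the Courant-Fischer principle. A plane contains a nonzero vector orthogonal
  to a given eigenvector; if all other eigenvalues were below \<open>\<mu>\<close>, the form at this
  vector would be below \<open>\<mu>\<close> times its squared length.\<close>

theorem second_eigenvalue_ge:
  fixes A :: "real mat"
  assumes A: "A \<in> carrier_mat n n" and sym: "transpose_mat A = A" and n: "2 \<le> n"
    and x: "x \<in> carrier_vec n" and y: "y \<in> carrier_vec n"
    and indep: "\<And>\<alpha> \<beta>. \<alpha> \<cdot>\<^sub>v x + \<beta> \<cdot>\<^sub>v y = 0\<^sub>v n \<Longrightarrow> \<alpha> = 0 \<and> \<beta> = 0"
    and form: "\<And>\<alpha> \<beta> z. z = \<alpha> \<cdot>\<^sub>v x + \<beta> \<cdot>\<^sub>v y \<Longrightarrow> \<mu> * (z \<bullet> z) \<le> z \<bullet> (A *\<^sub>v z)"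
  shows "\<mu> \<le> eigvals_desc A ! 1"
proof (rule ccontr)
  assume less: "\<not> ?thesis"
  obtain P D where PD: "similar_mat_wit A D P (transpose_mat P)" and diag: "diagonal_mat D"
    using real_spectral_theorem[OF A sym] by blast
  note w = similar_mat_witD2[OF A PD]
  let ?T = "transpose_mat P"
  have T: "?T \<in> carrier_mat n n" using w(6) by simp
  have "upper_triangular D" using diag w(5) unfolding diagonal_mat_def upper_triangular_def by auto
  then have cp: "char_poly A = (\<Prod>e\<leftarrow>diag_mat D. [:- e, 1:])"
    using char_poly_similar[of A D] char_poly_upper_triangular[OF w(5)] PD unfolding similar_mat_def by auto
  have ev: "eigvals_desc A = rev (sort (diag_mat D))"
    unfolding eigvals_desc_def cp proots_prod_list_linear by (simp add: sorted_list_of_multiset_mset)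
  have len: "length (diag_mat D) = n" and nth: "\<And>i. i < n \<Longrightarrow> diag_mat D ! i = D $$ (i, i)"
    using w(5) unfolding diag_mat_def by auto
  obtain i0 where i0: "\<And>j. j < n \<Longrightarrow> j \<noteq> i0 \<Longrightarrow> D $$ (j, j) < \<mu>"
    using at_most_one_index_ge[of "diag_mat D" \<mu>] len less nth n unfolding ev by (metis not_less)
  have adj: "z \<bullet> (P *\<^sub>v u) = (?T *\<^sub>v z) \<bullet> u" if "z \<in> carrier_vec n" "u \<in> carrier_vec n" for z u
    using transpose_vec_mult_scalar[OF w(6) that(2,1)] that w(6) T
    by (metis comm_scalar_prod mult_mat_vec_carrier)
  have norm: "z \<bullet> z = (\<Sum>i<n. ((?T *\<^sub>v z) $ i)\<^sup>2)" if z: "z \<in> carrier_vec n" for z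
  proof -
    have "z = P *\<^sub>v (?T *\<^sub>v z)"
      using assoc_mult_mat_vec[OF w(6) T z] w(1) z by simp
    then have "z \<bullet> z = (?T *\<^sub>v z) \<bullet> (?T *\<^sub>v z)"
      using adj[OF z, of "?T *\<^sub>v z"] T z by simp
    then show ?thesis using T by (simp add: scalar_prod_def power2_eq_square atLeast0LessThan)
  qed
  have quad: "z \<bullet> (A *\<^sub>v z) = (\<Sum>i<n. D $$ (i, i) * ((?T *\<^sub>v z) $ i)\<^sup>2)" if z: "z \<in> carrier_vec n" for z
  proof -
    have Tz: "?T *\<^sub>v z \<in> carrier_vec n" using T z by auto
    have "A *\<^sub>v z = P *\<^sub>v (D *\<^sub>v (?T *\<^sub>v z))"
      using w T z Tz by (simp add: assoc_mult_mat_vec[of _ n n _ n])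
    then have "z \<bullet> (A *\<^sub>v z) = (?T *\<^sub>v z) \<bullet> (D *\<^sub>v (?T *\<^sub>v z))"
      using adj[OF z] w(5) Tz by simp
    also have "\<dots> = (\<Sum>i<n. (?T *\<^sub>v z) $ i * (\<Sum>j<n. D $$ (i, j) * (?T *\<^sub>v z) $ j))"
      using w(5) T by (simp add: scalar_prod_def atLeast0LessThan)
    also have "\<dots> = (\<Sum>i<n. D $$ (i, i) * ((?T *\<^sub>v z) $ i)\<^sup>2)"
    proof (rule sum.cong)
      fix i assume "i \<in> {..<n}"
      then have "(\<Sum>j<n. D $$ (i, j) * (?T *\<^sub>v z) $ j) = (\<Sum>j<n. if j = i then D $$ (i, i) * (?T *\<^sub>v z) $ i else 0)"
        using diag w(5) unfolding diagonal_mat_def by (intro sum.cong) auto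
      also have "\<dots> = D $$ (i, i) * (?T *\<^sub>v z) $ i" using \<open>i \<in> {..<n}\<close> by simp
      finally show "(?T *\<^sub>v z) $ i * (\<Sum>j<n. D $$ (i, j) * (?T *\<^sub>v z) $ j) = D $$ (i, i) * ((?T *\<^sub>v z) $ i)\<^sup>2"
        by (simp add: power2_eq_square)
    qed simp
    finally show ?thesis .
  qed
  define a b where "a = (?T *\<^sub>v x) $ i0" and "b = (?T *\<^sub>v y) $ i0"
  \<comment> \<open>A nonzero solution of \<open>\<alpha> * a + \<beta> * b = 0\<close>: the pair
    \<open>(b, - a)\<close>, or \<open>(1, 0)\<close> when both coefficients vanish. The combination
    then has no component along the eigenvector with index \<open>i0\<close>.\<close>
  define \<alpha> \<beta> where "\<alpha> = (if a = 0 \<and> b = 0 then 1 else b)" and "\<beta> = (if a = 0 \<and> b = 0 then 0 else - a)"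
  define z where "z = \<alpha> \<cdot>\<^sub>v x + \<beta> \<cdot>\<^sub>v y"
  have z: "z \<in> carrier_vec n" unfolding z_def using x y by simp
  have z0: "z \<noteq> 0\<^sub>v n"
    using indep[of \<alpha> \<beta>] unfolding z_def \<alpha>_def \<beta>_def by (auto split: if_splits)
  let ?c = "\<lambda>i. (?T *\<^sub>v z) $ i"
  have c0: "?c i0 = 0" if "i0 < n"
  proof -
    have "?T *\<^sub>v z = \<alpha> \<cdot>\<^sub>v (?T *\<^sub>v x) + \<beta> \<cdot>\<^sub>v (?T *\<^sub>v y)"
      unfolding z_def using T x y by (simp add: mult_add_distrib_mat_vec[of _ n n] mult_mat_vec[of _ n n])
    then have "?c i0 = \<alpha> * a + \<beta> * b" unfolding a_def b_def using that T by simp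
    then show ?thesis unfolding \<alpha>_def \<beta>_def by (simp split: if_splits)
  qed
  have "\<exists>i<n. ?c i \<noteq> 0"
  proof (rule ccontr)
    assume "\<not> ?thesis"
    then have "z \<bullet> z = 0" using norm[OF z] by simp
    then have "(\<Sum>i<n. (z $ i)\<^sup>2) = 0" using z by (simp add: scalar_prod_def power2_eq_square atLeast0LessThan)
    then have "\<forall>i<n. z $ i = 0" by (simp add: sum_nonneg_eq_0_iff)
    then have "z = 0\<^sub>v n" using z by (intro eq_vecI) auto
    then show False using z0 by contradiction
  qed
  then obtain i1 where i1: "i1 < n" "?c i1 \<noteq> 0" by auto
  have "z \<bullet> (A *\<^sub>v z) < (\<Sum>i<n. \<mu> * (?c i)\<^sup>2)"
    unfolding quad[OF z]
  proof (rule sum_strict_mono_ex1)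
    show "\<forall>i\<in>{..<n}. D $$ (i, i) * (?c i)\<^sup>2 \<le> \<mu> * (?c i)\<^sup>2"
      using i0 c0 by (metis lessThan_iff less_imp_le mult_right_mono zero_le_power2 mult_zero_right zero_power2 order_refl)
    show "\<exists>i\<in>{..<n}. D $$ (i, i) * (?c i)\<^sup>2 < \<mu> * (?c i)\<^sup>2"
      using i0[OF i1(1)] c0 i1 by (intro bexI[of _ i1]) auto
  qed simp
  also have "\<dots> = \<mu> * (z \<bullet> z)" unfolding norm[OF z] by (simp add: sum_distrib_left)
  finally show False using form[OF z_def] by simp
qed

section \<open>Packing forests\<close>

text \<open>
  An undirected edge is represented by either one of its two orientations; only the equivalence
  relation generated by a set of pairs matters. It is the closure operator of the cycle matroid.
\<close>

definition econn :: "('a \<times> 'a) set \<Rightarrow> ('a \<times> 'a) set" where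
  "econn S = (S \<union> S\<inverse>)\<^sup>*"

lemma econn_refl [simp]: "(x, x) \<in> econn S"
  by (simp add: econn_def)

lemma econn_sym: "(x, y) \<in> econn S \<Longrightarrow> (y, x) \<in> econn S"
  unfolding econn_def by (rule symD[OF sym_rtrancl[OF sym_Un_converse]])

lemma econn_trans: "(x, y) \<in> econn S \<Longrightarrow> (y, z) \<in> econn S \<Longrightarrow> (x, z) \<in> econn S"
  unfolding econn_def by (rule rtrancl_trans)

lemma econn_mono: "S \<subseteq> T \<Longrightarrow> econn S \<subseteq> econn T"
  unfolding econn_def by (intro rtrancl_mono) auto

lemma subset_econn: "S \<subseteq> econn S"
  unfolding econn_def by auto

lemma econn_least:
  assumes "S \<subseteq> econn T"
  shows "econn S \<subseteq> econn T"
proof -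
  have "S\<inverse> \<subseteq> econn T"
  proof (rule subrelI)
    fix x y assume "(x, y) \<in> S\<inverse>"
    then have "(y, x) \<in> econn T" using assms by blast
    then show "(x, y) \<in> econn T" by (rule econn_sym)
  qed
  with assms have "S \<union> S\<inverse> \<subseteq> (T \<union> T\<inverse>)\<^sup>*"
    by (simp add: econn_def)
  then show ?thesis
    unfolding econn_def by (rule rtrancl_subset_rtrancl)
qed

lemma equiv_econn: "equiv UNIV (econn S)"
  by (intro equivI refl_onI symI transI) (auto intro: econn_sym econn_trans)

text \<open>Three states suffice along a walk: the new edge has not been crossed, or it has been
  crossed once in one direction or the other. A further crossing leads back into one of these
  states.\<close>

lemma econn_insertD:
  assumes "(x, y) \<in> econn (insert (a, b) S)"
  shows "(x, y) \<in> econn S \<or> (x, a) \<in> econn S \<and> (b, y) \<in> econn S \<or> (x, b) \<in> econn S \<and> (a, y) \<in> econn S"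
  using assms[unfolded econn_def]
proof (induction rule: rtrancl_induct)
  case base
  then show ?case by simp
next
  case (step y z)
  consider "(y, z) \<in> S" | "(z, y) \<in> S" | "y = a" "z = b" | "y = b" "z = a"
    using step.hyps(2) by auto
  then show ?case
  proof cases
    case 1
    then have "(y, z) \<in> econn S" using subset_econn[of S] by blast
    then show ?thesis using step.IH econn_trans[of _ y S z] by metis
  next
    case 2
    then have "(z, y) \<in> econn S" using subset_econn[of S] by blast
    then have "(y, z) \<in> econn S" by (rule econn_sym)
    then show ?thesis using step.IH econn_trans[of _ y S z] by metis
  next
    case 3
    then show ?thesis using step.IH[unfolded econn_def[symmetric]] econn_trans[of x b S a] econn_sym[of b a S] by auto
  next
    case 4
    then show ?thesis using step.IH[unfolded econn_def[symmetric]] econn_trans[of x a S b] econn_sym[of a b S] by auto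
  qed
qed

text \<open>The exchange axiom of matroid closure. A walk joining the ends of \<open>e\<close> has
  to pass through \<open>f\<close>; together with \<open>e\<close> it closes up, and the rest of the
  closed walk is a detour around \<open>f\<close>.\<close>

lemma econn_exchange:
  assumes "e \<in> econn (insert f S)" "e \<notin> econn S"
  shows "f \<in> econn (insert e S)"
proof -
  obtain x y a b where e: "e = (x, y)" and f: "f = (a, b)"
    by (cases e, cases f)
  have m: "econn S \<subseteq> econn (insert e S)" and xy: "(x, y) \<in> econn (insert e S)"
    using econn_mono[of S "insert e S"] subset_econn[of "insert e S"] e by auto
  have "(x, a) \<in> econn S \<and> (b, y) \<in> econn S \<or> (x, b) \<in> econn S \<and> (a, y) \<in> econn S"
    using assms econn_insertD unfolding e f by metis
  then have "(x, a) \<in> econn (insert e S) \<and> (b, y) \<in> econn (insert e S) \<or>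
      (x, b) \<in> econn (insert e S) \<and> (a, y) \<in> econn (insert e S)"
    using m by auto
  then show ?thesis
  proof (elim disjE conjE)
    assume "(x, a) \<in> econn (insert e S)" "(b, y) \<in> econn (insert e S)"
    then show ?thesis
      using econn_trans[OF econn_trans[OF econn_sym xy]] econn_sym unfolding f by metis
  next
    assume "(x, b) \<in> econn (insert e S)" "(a, y) \<in> econn (insert e S)"
    then show ?thesis
      using econn_trans[OF _ econn_trans[OF econn_sym[OF xy]]] unfolding f by metis
  qed
qed

text \<open>Independence in the cycle matroid. Since pairs stand for edges, it also rules out loops
  and the presence of both orientations of one edge.\<close>

definition eforest :: "('a \<times> 'a) set \<Rightarrow> bool" where
  "eforest S \<longleftrightarrow> (\<forall>e\<in>S. e \<notin> econn (S - {e}))"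

lemma eforest_subset: "eforest S \<Longrightarrow> T \<subseteq> S \<Longrightarrow> eforest T"
  unfolding eforest_def using econn_mono by (metis Diff_mono order_refl subset_iff)

lemma eforest_insert:
  assumes "eforest S" "e \<notin> econn S"
  shows "eforest (insert e S)"
  unfolding eforest_def
proof
  fix f assume f: "f \<in> insert e S"
  show "f \<notin> econn (insert e S - {f})"
  proof (cases "f = e")
    case True
    then show ?thesis using assms(2) econn_mono[of "insert e S - {f}" S] by auto
  next
    case False
    then have fS: "f \<in> S" and eq: "insert e S - {f} = insert e (S - {f})" using f by auto
    show ?thesis
    proof
      assume "f \<in> econn (insert e S - {f})"
      then have "e \<in> econn (insert f (S - {f}))"
        using econn_exchange eq fS assms(1) unfolding eforest_def by metis
      then show False using assms(2) fS by (simp add: insert_absorb)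
    qed
  qed
qed

text \<open>If \<open>F\<close> is a forest whose closure contains \<open>e\<close>, this is the
  path in \<open>F\<close> between the ends of \<open>e\<close>, that is, the fundamental circuit
  without \<open>e\<close>. Describing it by removals gives at once that
  \<open>insert e (F - {f})\<close> is again a forest.\<close>

definition circuit :: "('a \<times> 'a) set \<Rightarrow> 'a \<times> 'a \<Rightarrow> ('a \<times> 'a) set" where
  "circuit F e = {f \<in> F. e \<notin> econn (F - {f})}"

text \<open>Take a minimal \<open>P \<subseteq> F\<close> whose closure contains \<open>e\<close>.
  If \<open>e\<close> were still in the closure of \<open>F - {f}\<close> for some
  \<open>f \<in> P\<close>, exchanging inside \<open>P\<close> would put \<open>f\<close> into that
  closure too, against independence of \<open>F\<close>. So \<open>P\<close> lies in the
  circuit.\<close>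

lemma econn_circuit:
  assumes "finite F" "eforest F" "e \<in> econn F"
  shows "e \<in> econn (circuit F e)"
proof -
  have "\<exists>P. P \<subseteq> F \<and> e \<in> econn P \<and> (\<forall>Q. Q \<subset> P \<longrightarrow> e \<notin> econn Q)"
  proof -
    let ?Ps = "{P. P \<subseteq> F \<and> e \<in> econn P}"
    have "finite ?Ps" "F \<in> ?Ps" using assms by auto
    then have "\<exists>P\<in>?Ps. \<forall>Q\<in>?Ps. Q \<subseteq> P \<longrightarrow> P = Q"
      using finite_has_minimal[of ?Ps] by force
    then obtain P where "P \<subseteq> F" "e \<in> econn P" and "\<And>Q. Q \<subseteq> F \<Longrightarrow> e \<in> econn Q \<Longrightarrow> Q \<subseteq> P \<Longrightarrow> P = Q"
      by auto
    then show ?thesis by (intro exI[of _ P]) (simp, metis psubset_eq subset_trans)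
  qed
  then obtain P where P: "P \<subseteq> F" "e \<in> econn P" and min: "\<And>Q. Q \<subset> P \<Longrightarrow> e \<notin> econn Q"
    by blast
  have "P \<subseteq> circuit F e"
  proof
    fix f assume f: "f \<in> P"
    have "e \<notin> econn (F - {f})"
    proof
      assume e: "e \<in> econn (F - {f})"
      have "e \<notin> econn (P - {f})" using min f by blast
      then have "f \<in> econn (insert e (P - {f}))"
        using econn_exchange[of e f "P - {f}"] P f by (simp add: insert_absorb)
      moreover have "insert e (P - {f}) \<subseteq> econn (F - {f})"
        using e P subset_econn[of "F - {f}"] by auto
      ultimately have "f \<in> econn (F - {f})" using econn_least by blast
      then show False using assms(2) f P unfolding eforest_def by auto
    qed
    then show "f \<in> circuit F e" using f P unfolding circuit_def by auto
  qed
  then show ?thesis using P(2) econn_mono by blast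
qed

text \<open>The invariant of the exchange process: inside any \<open>R\<close> that contains the
  whole circuit, each of \<open>e\<close> and \<open>f\<close> lies in the closure of the other
  together with the rest of the circuit.\<close>

lemma econn_swap:
  assumes F: "finite F" "eforest F" "e \<in> econn F" and f: "f \<in> circuit F e"
    and R: "circuit F e \<subseteq> R" "e \<in> R" and e: "e \<notin> F"
  shows "econn (insert e (F - {f}) \<inter> R) = econn (F \<inter> R)"
proof
  let ?C = "circuit F e"
  have CF: "?C \<subseteq> F" unfolding circuit_def by auto
  have eC: "e \<in> econn ?C" using econn_circuit[OF F] .
  then have "e \<in> econn (F \<inter> R)" using econn_mono[of ?C "F \<inter> R"] CF R by auto
  then show "econn (insert e (F - {f}) \<inter> R) \<subseteq> econn (F \<inter> R)"
    using subset_econn[of "F \<inter> R"] by (intro econn_least) auto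
  have "e \<notin> econn (?C - {f})"
    using f econn_mono[of "?C - {f}" "F - {f}"] CF unfolding circuit_def by auto
  then have "f \<in> econn (insert e (?C - {f}))"
    using econn_exchange[of e f "?C - {f}"] eC f by (simp add: insert_absorb)
  then have "f \<in> econn (insert e (F - {f}) \<inter> R)"
    using econn_mono[of "insert e (?C - {f})" "insert e (F - {f}) \<inter> R"] CF R by auto
  then show "econn (F \<inter> R) \<subseteq> econn (insert e (F - {f}) \<inter> R)"
    using subset_econn[of "insert e (F - {f}) \<inter> R"] by (intro econn_least) auto
qed

section \<open>The size of a forest and its number of components\<close>

lemma card_quotient_econn_insert:
  assumes "finite V" "a \<in> V" "b \<in> V" "(a, b) \<notin> econn S"
  shows "card (V // econn S) = Suc (card (V // econn (insert (a, b) S)))"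
proof -
  let ?r = "econn S" and ?r' = "econn (insert (a, b) S)"
  let ?A = "?r `` {a}" and ?B = "?r `` {b}"
  have iff: "(x, y) \<in> ?r' \<longleftrightarrow> (x, y) \<in> ?r \<or> (x, a) \<in> ?r \<and> (b, y) \<in> ?r \<or> (x, b) \<in> ?r \<and> (a, y) \<in> ?r" for x y
  proof
    have m: "?r \<subseteq> ?r'" by (rule econn_mono) auto
    have ab: "(a, b) \<in> ?r'" using subset_econn by blast
    show "(x, y) \<in> ?r \<or> (x, a) \<in> ?r \<and> (b, y) \<in> ?r \<or> (x, b) \<in> ?r \<and> (a, y) \<in> ?r \<Longrightarrow> (x, y) \<in> ?r'"
      using m ab econn_sym[OF ab] by (elim disjE conjE) (blast intro: econn_trans)+
  qed (rule econn_insertD)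
  have eq: "?r `` {x} = ?r `` {y} \<longleftrightarrow> (x, y) \<in> ?r" for x y
    using equiv_econn[of S] by (simp add: equiv_class_eq_iff)
  have cls: "?r' `` {x} = (if (x, a) \<in> ?r \<or> (x, b) \<in> ?r then ?A \<union> ?B else ?r `` {x})" for x
  proof (cases "(x, a) \<in> ?r")
    case True
    then have "?r `` {x} = ?A" by (simp add: eq)
    then have "(x, y) \<in> ?r \<longleftrightarrow> (a, y) \<in> ?r" for y by (simp add: set_eq_iff)
    then have "y \<in> ?r' `` {x} \<longleftrightarrow> y \<in> ?A \<union> ?B" for y using True by (simp add: iff) argo
    then show ?thesis using True by (simp add: set_eq_iff)
  next
    case False
    show ?thesis
    proof (cases "(x, b) \<in> ?r")
      case True
      then have "?r `` {x} = ?B" by (simp add: eq)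
      then have "(x, y) \<in> ?r \<longleftrightarrow> (b, y) \<in> ?r" for y by (simp add: set_eq_iff)
      then have "y \<in> ?r' `` {x} \<longleftrightarrow> y \<in> ?A \<union> ?B" for y using True False by (simp add: iff) argo
      then show ?thesis using True by (simp add: set_eq_iff)
    next
      case F: False
      then have "y \<in> ?r' `` {x} \<longleftrightarrow> y \<in> ?r `` {x}" for y using False by (simp add: iff)
      then show ?thesis using False F by (simp add: set_eq_iff)
    qed
  qed
  have Q: "V // ?r' = insert (?A \<union> ?B) (V // ?r - {?A, ?B})"
  proof (intro equalityI subsetI)
    fix X assume "X \<in> V // ?r'"
    then obtain x where x: "x \<in> V" "X = ?r' `` {x}" by (auto simp: quotient_def)
    then show "X \<in> insert (?A \<union> ?B) (V // ?r - {?A, ?B})"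
      using cls[of x] eq quotientI[OF x(1), of ?r] by (auto split: if_splits)
  next
    fix X assume "X \<in> insert (?A \<union> ?B) (V // ?r - {?A, ?B})"
    then consider "X = ?A \<union> ?B" | x where "x \<in> V" "X = ?r `` {x}" "X \<noteq> ?A" "X \<noteq> ?B"
      by (auto simp: quotient_def)
    then show "X \<in> V // ?r'"
    proof cases
      case 1
      then show ?thesis using cls[of a] quotientI[OF assms(2), of ?r'] by simp
    next
      case 2
      then show ?thesis using cls[of x] eq quotientI[OF 2(1), of ?r'] by simp
    qed
  qed
  have "?A \<noteq> ?B" using eq assms(4) by simp
  moreover have "?A \<in> V // ?r" "?B \<in> V // ?r" using assms(2,3) by (auto intro: quotientI)
  moreover have "?A \<union> ?B \<notin> V // ?r"
  proof
    assume "?A \<union> ?B \<in> V // ?r"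
    then obtain x where x: "?A \<union> ?B = ?r `` {x}" by (auto simp: quotient_def)
    have "a \<in> ?A \<union> ?B" "b \<in> ?A \<union> ?B" by simp_all
    then have "(x, a) \<in> ?r" "(x, b) \<in> ?r" unfolding x by simp_all
    then show False using assms(4) econn_sym econn_trans by metis
  qed
  moreover have fin: "finite (V // ?r)"
    using assms(1) unfolding quotient_def by simp
  ultimately have "card (V // ?r') = Suc (card (V // ?r) - 2)" "card (V // ?r) \<ge> 2"
    unfolding Q using card_mono[of "V // ?r" "{?A, ?B}"]
    by (simp_all add: card_insert_if card_Diff_subset)
  then show ?thesis by simp
qed

lemma card_eforest:
  assumes V: "finite V" and S: "S \<subseteq> V \<times> V" and forest: "eforest S"
  shows "card S + card (V // econn S) = card V"
proof -
  have "finite S" using V S finite_subset by blast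
  then show ?thesis using S forest
  proof (induction S rule: finite_induct)
    case empty
    have "V // econn {} = (\<lambda>x. {x}) ` V" unfolding econn_def quotient_def by auto
    then show ?case by (simp add: card_image)
  next
    case (insert e S)
    obtain a b where e: "e = (a, b)" by (cases e)
    have "e \<notin> econn S" using insert.prems(2) insert.hyps(2) unfolding eforest_def by auto
    then show ?case
      using insert card_quotient_econn_insert[OF V, of a b S] eforest_subset[OF insert.prems(2)]
      by (auto simp: e)
  qed
qed

section \<open>Disjoint forests, exchanges, and the partition they produce\<close>

definition forest_tuple :: "('a \<times> 'a) set \<Rightarrow> nat \<Rightarrow> (nat \<Rightarrow> ('a \<times> 'a) set) \<Rightarrow> bool" where
  "forest_tuple E k F \<longleftrightarrow> (\<forall>i<k. F i \<subseteq> E \<and> eforest (F i)) \<and> (\<forall>i<k. \<forall>j<k. i \<noteq> j \<longrightarrow> F i \<inter> F j = {})"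

definition uncovered :: "('a \<times> 'a) set \<Rightarrow> nat \<Rightarrow> (nat \<Rightarrow> ('a \<times> 'a) set) \<Rightarrow> ('a \<times> 'a) set" where
  "uncovered E k F = E - (\<Union>i<k. F i)"

text \<open>The edge \<open>f\<close> that leaves becomes uncovered and may next enter another
  forest. The sizes stay fixed, so a tuple of largest total size stays largest.\<close>

inductive exch :: "('a \<times> 'a) set \<Rightarrow> nat \<Rightarrow> (nat \<Rightarrow> ('a \<times> 'a) set) \<Rightarrow> (nat \<Rightarrow> ('a \<times> 'a) set) \<Rightarrow> bool"
  for E k F where
  "i < k \<Longrightarrow> e \<in> uncovered E k F \<Longrightarrow> f \<in> circuit (F i) e \<Longrightarrow> exch E k F (F(i := insert e (F i - {f})))"

lemma forest_tuple_update:
  assumes "forest_tuple E k F" "i < k" "S \<subseteq> E" "eforest S" "\<And>j. j < k \<Longrightarrow> j \<noteq> i \<Longrightarrow> F j \<inter> S = {}"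
  shows "forest_tuple E k (F(i := S))"
  using assms unfolding forest_tuple_def by (auto simp: Int_commute)

lemma exch_valid:
  assumes "exch E k F F'" "forest_tuple E k F" "finite E"
  shows "forest_tuple E k F' \<and> (\<Sum>i<k. card (F' i)) = (\<Sum>i<k. card (F i))"
  using assms(1)
proof cases
  case (1 i e f)
  have F: "F i \<subseteq> E" "eforest (F i)" "\<And>j. j < k \<Longrightarrow> j \<noteq> i \<Longrightarrow> F j \<inter> F i = {}"
    using assms(2) 1(2) unfolding forest_tuple_def by auto
  have e: "e \<in> E" "\<And>j. j < k \<Longrightarrow> e \<notin> F j" using 1(3) unfolding uncovered_def by auto
  have f: "f \<in> F i" "e \<notin> econn (F i - {f})" using 1(4) unfolding circuit_def by auto
  have "eforest (insert e (F i - {f}))"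
    using eforest_insert[OF eforest_subset[OF F(2)] f(2)] by auto
  moreover have "F j \<inter> insert e (F i - {f}) = {}" if "j < k" "j \<noteq> i" for j
    using F(3)[OF that] e(2)[OF that(1)] by auto
  ultimately have "forest_tuple E k F'"
    unfolding 1(1) using e(1) F(1) by (intro forest_tuple_update[OF assms(2) 1(2)]) auto
  moreover have "finite (F i)" using F(1) assms(3) finite_subset by blast
  then have "card (insert e (F i - {f})) = card (F i)"
    using e(2)[OF 1(2)] f(1) by (metis card.insert card_Suc_Diff1 finite_Diff insertE insert_Diff_single insert_absorb Diff_iff)
  then have "(\<Sum>i<k. card (F' i)) = (\<Sum>i<k. card (F i))"
    unfolding 1(1) by (intro sum.cong) auto
  ultimately show ?thesis by simp
qed

lemma exch_rtranclp_valid: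
  assumes "(exch E k)\<^sup>*\<^sup>* F F'" "forest_tuple E k F" "finite E"
  shows "forest_tuple E k F' \<and> (\<Sum>i<k. card (F' i)) = (\<Sum>i<k. card (F i))"
  using assms(1)
proof (induction rule: rtranclp_induct)
  case base
  then show ?case using assms by simp
next
  case (step F1 F2)
  then show ?case using exch_valid[OF step.hyps(2) _ assms(3)] by simp
qed

text \<open>
  The set \<open>R\<close> collects the edges left uncovered by some tuple reachable from \<open>F\<close> through exchanges.
  For such a tuple the fundamental circuits of uncovered edges lie inside \<open>R\<close>, so an exchange does
  not change the closures of the intersections with \<open>R\<close>. Working with single exchanges in place of
  augmenting paths avoids the shortest-path argument of the matroid union theorem.
\<close>

theorem max_tuple_structure:
  assumes E: "finite E" and F: "forest_tuple E k F"
    and max: "\<And>F'. forest_tuple E k F' \<Longrightarrow> (\<Sum>i<k. card (F' i)) \<le> (\<Sum>i<k. card (F i))"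
  obtains R where "R \<subseteq> E" "E - R \<subseteq> (\<Union>i<k. F i)" "\<And>i. i < k \<Longrightarrow> econn (F i \<inter> R) = econn R"
proof -
  define R where "R = (\<Union>F' \<in> {F'. (exch E k)\<^sup>*\<^sup>* F F'}. uncovered E k F')"
  have R_E: "R \<subseteq> E" unfolding R_def uncovered_def by auto
  \<comment> \<open>Otherwise \<open>e\<close> could be added to \<open>F' i\<close>. As exchanges
    preserve the total size, this would beat the maximum.\<close>
  have conn: "e \<in> econn (F' i)" if F': "(exch E k)\<^sup>*\<^sup>* F F'" and e: "e \<in> uncovered E k F'" and i: "i < k" for F' e i
  proof (rule ccontr)
    assume ne: "e \<notin> econn (F' i)"
    have v: "forest_tuple E k F'" and s: "(\<Sum>i<k. card (F' i)) = (\<Sum>i<k. card (F i))"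
      using exch_rtranclp_valid[OF F' F E] by auto
    have Fi: "F' i \<subseteq> E" "eforest (F' i)" "\<And>j. j < k \<Longrightarrow> j \<noteq> i \<Longrightarrow> F' j \<inter> F' i = {}"
      using v i unfolding forest_tuple_def by auto
    have e': "e \<in> E" "\<And>j. j < k \<Longrightarrow> e \<notin> F' j" using e unfolding uncovered_def by auto
    let ?F = "F'(i := insert e (F' i))"
    have "F' j \<inter> insert e (F' i) = {}" if "j < k" "j \<noteq> i" for j
      using Fi(3)[OF that] e'(2)[OF that(1)] by auto
    then have "forest_tuple E k ?F"
      using Fi(1) e'(1) eforest_insert[OF Fi(2) ne] by (intro forest_tuple_update[OF v i]) auto
    then have "(\<Sum>j<k. card (?F j)) \<le> (\<Sum>j<k. card (F' j))" using max[of ?F] s by linarith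
    moreover have "(\<Sum>j<k. card (F' j)) < (\<Sum>j<k. card (?F j))"
    proof (rule sum_strict_mono_ex1)
      have "finite (F' i)" using Fi(1) E finite_subset by blast
      then have c: "card (insert e (F' i)) = Suc (card (F' i))" using e'(2)[OF i] by simp
      then show "\<forall>j\<in>{..<k}. card (F' j) \<le> card (?F j)" by auto
      show "\<exists>j\<in>{..<k}. card (F' j) < card (?F j)" using c i by (intro bexI[of _ i]) auto
    qed simp
    ultimately show False by simp
  qed
  \<comment> \<open>Exchanging \<open>e\<close> for \<open>f\<close> uncovers \<open>f\<close>, and
    the resulting tuple is again reachable.\<close>
  have circ: "circuit (F' i) e \<subseteq> R" if F': "(exch E k)\<^sup>*\<^sup>* F F'" and e: "e \<in> uncovered E k F'" and i: "i < k" for F' e i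
  proof
    fix f assume f: "f \<in> circuit (F' i) e"
    let ?F = "F'(i := insert e (F' i - {f}))"
    have v: "forest_tuple E k F'" using exch_rtranclp_valid[OF F' F E] by auto
    have fi: "f \<in> F' i" using f unfolding circuit_def by auto
    have "exch E k F' ?F" using exch.intros[OF i e f] .
    with F' have "(exch E k)\<^sup>*\<^sup>* F ?F" by auto
    moreover have "f \<in> uncovered E k ?F"
    proof -
      have "F' i \<subseteq> E" and disj: "\<And>j. j < k \<Longrightarrow> j \<noteq> i \<Longrightarrow> F' i \<inter> F' j = {}"
        using v i unfolding forest_tuple_def by auto
      then have "f \<in> E" "\<And>j. j < k \<Longrightarrow> j \<noteq> i \<Longrightarrow> f \<notin> F' j"
        using fi by auto
      moreover have "f \<noteq> e" using fi e i unfolding uncovered_def by auto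
      ultimately show ?thesis unfolding uncovered_def by auto
    qed
    ultimately show "f \<in> R" unfolding R_def by auto
  qed
  have inv: "econn (F' i \<inter> R) = econn (F i \<inter> R)" if "(exch E k)\<^sup>*\<^sup>* F F'" "i < k" for F' i
    using that
  proof (induction rule: rtranclp_induct)
    case (step F1 F2)
    have v: "forest_tuple E k F1" using exch_rtranclp_valid[OF step.hyps(1) F E] by auto
    from step.hyps(2) show ?case
    proof cases
      case (1 j e f)
      have "econn (insert e (F1 j - {f}) \<inter> R) = econn (F1 j \<inter> R)"
      proof (rule econn_swap)
        show "finite (F1 j)" "eforest (F1 j)"
          using v 1(2) E finite_subset unfolding forest_tuple_def by auto
        show "e \<in> econn (F1 j)" "circuit (F1 j) e \<subseteq> R"
          using conn circ step.hyps(1) 1 by auto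
        show "e \<in> R" using step.hyps(1) 1(3) unfolding R_def by auto
        show "e \<notin> F1 j" using 1(2,3) unfolding uncovered_def by auto
      qed (use 1 in auto)
      then show ?thesis using step unfolding 1(1) by auto
    qed
  qed simp
  show thesis
  proof
    show "E - R \<subseteq> (\<Union>i<k. F i)" unfolding R_def uncovered_def by auto
    fix i assume i: "i < k"
    have "e \<in> econn (F i \<inter> R)" if "e \<in> R" for e
    proof -
      obtain F' where F': "(exch E k)\<^sup>*\<^sup>* F F'" and e: "e \<in> uncovered E k F'"
        using \<open>e \<in> R\<close> unfolding R_def by auto
      have v: "forest_tuple E k F'" using exch_rtranclp_valid[OF F' F E] by auto
      then have "finite (F' i)" "eforest (F' i)"
        using i E finite_subset unfolding forest_tuple_def by auto
      then have "e \<in> econn (circuit (F' i) e)" using econn_circuit conn[OF F' e i] by blast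
      moreover have "circuit (F' i) e \<subseteq> F' i \<inter> R"
        using circ[OF F' e i] unfolding circuit_def by auto
      ultimately have "e \<in> econn (F' i \<inter> R)" using econn_mono by blast
      then show ?thesis using inv[OF F' i] by simp
    qed
    then have "econn R \<subseteq> econn (F i \<inter> R)" by (intro econn_least) blast
    then show "econn (F i \<inter> R) = econn R"
      using econn_mono[of "F i \<inter> R" R] by simp
  qed (rule R_E)
qed

text \<open>The hard direction of the Nash-Williams--Tutte theorem. For a largest tuple and its
  \<open>R\<close>, the forests cover all of \<open>E - R\<close>, and each has exactly
  \<open>card V - card (V // econn R)\<close> edges inside \<open>R\<close>. If some forest does not
  span, the total is below \<open>k * (card V - 1)\<close>; subtracting the edges inside
  \<open>R\<close> leaves the bound on \<open>E - R\<close>.\<close>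

theorem tree_packing_or_partition:
  assumes V: "finite V" "V \<noteq> {}" and E: "E \<subseteq> V \<times> V"
  shows "(\<exists>F. forest_tuple E k F \<and> (\<forall>i<k. V \<times> V \<subseteq> econn (F i))) \<or>
    (\<exists>R\<subseteq>E. card (E - R) < k * (card (V // econn R) - 1))"
proof -
  have finE: "finite E" using V E finite_subset by blast
  define P where "P F \<longleftrightarrow> forest_tuple E k F" for F
  define m where "m F = (\<Sum>i<k. card (F i))" for F :: "nat \<Rightarrow> ('a \<times> 'a) set"
  have "P (\<lambda>_. {})" unfolding P_def forest_tuple_def eforest_def by auto
  moreover have "m F < Suc (k * card E)" if "P F" for F
  proof -
    have "m F \<le> (\<Sum>i<k. card E)"
      unfolding m_def using that finE unfolding P_def forest_tuple_def by (intro sum_mono card_mono) auto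
    then show ?thesis by simp
  qed
  ultimately obtain F where F: "forest_tuple E k F" and max: "\<And>F'. forest_tuple E k F' \<Longrightarrow> m F' \<le> m F"
    using ex_has_greatest_nat[of P "\<lambda>_. {}" m "Suc (k * card E)"] unfolding P_def by (metis less_imp_le)
  from max_tuple_structure[OF finE F max[unfolded m_def]] obtain R where R: "R \<subseteq> E"
    "E - R \<subseteq> (\<Union>i<k. F i)" and conn: "\<And>i. i < k \<Longrightarrow> econn (F i \<inter> R) = econn R" by blast
  have Fi: "F i \<subseteq> E" "eforest (F i)" "finite (F i)" if "i < k" for i
    using F that finE finite_subset unfolding forest_tuple_def by auto
  have card_F: "card (F i) + card (V // econn (F i)) = card V" if "i < k" for i
    using card_eforest[OF V(1) _ Fi(2)[OF that]] Fi(1)[OF that] E by auto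
  have card_FR: "card (F i \<inter> R) + card (V // econn R) = card V" if "i < k" for i
    using card_eforest[OF V(1), of "F i \<inter> R"] Fi[OF that] E eforest_subset[of "F i" "F i \<inter> R"] conn[OF that] by auto
  have Q: "finite (V // r)" "V // r \<noteq> {}" for r
    using V unfolding quotient_def by auto
  then have pos: "card (V // r) \<ge> 1" for r :: "('a \<times> 'a) set"
    by (metis One_nat_def Suc_leI card_gt_0_iff)
  show ?thesis
  proof (cases "\<forall>i<k. V \<times> V \<subseteq> econn (F i)")
    case True
    then show ?thesis using F by auto
  next
    case False
    then obtain i0 x y where i0: "i0 < k" and xy: "x \<in> V" "y \<in> V" "(x, y) \<notin> econn (F i0)" by auto
    have "econn (F i0) `` {x} \<noteq> econn (F i0) `` {y}"
      using xy(3) equiv_econn[of "F i0"] by (simp add: equiv_class_eq_iff)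
    moreover have "{econn (F i0) `` {x}, econn (F i0) `` {y}} \<subseteq> V // econn (F i0)"
      using xy by (auto intro: quotientI)
    ultimately have "card (V // econn (F i0)) \<ge> 2"
      using card_mono[OF Q(1)] by (metis card_2_iff)
    then have lt: "card (F i0) < card V - 1" using card_F[OF i0] by linarith
    have le: "card (F i) \<le> card V - 1" if "i < k" for i
      using card_F[OF that] pos[of "econn (F i)"] by linarith
    have "(\<Sum>i<k. card (F i)) < (\<Sum>i<k. card V - 1)"
      using lt le i0 by (intro sum_strict_mono_ex1) auto
    then have total: "(\<Sum>i<k. card (F i)) < k * (card V - 1)" by simp
    have "card (\<Union>i<k. F i) = (\<Sum>i<k. card (F i))"
      using F Fi by (intro card_UN_disjoint) (auto simp: forest_tuple_def)
    moreover have "card (\<Union>i<k. F i \<inter> R) = (\<Sum>i<k. card (F i \<inter> R))"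
      using F Fi by (intro card_UN_disjoint) (auto simp: forest_tuple_def)
    moreover have "card (F i \<inter> R) = card V - card (V // econn R)" if "i < k" for i
      using card_FR[OF that] by linarith
    then have "(\<Sum>i<k. card (F i \<inter> R)) = k * (card V - card (V // econn R))"
      by simp
    moreover have "card (\<Union>i<k. F i) = card (E - R) + card (\<Union>i<k. F i \<inter> R)"
    proof -
      have "(\<Union>i<k. F i) = (E - R) \<union> (\<Union>i<k. F i \<inter> R)" using R Fi by auto
      moreover have "(E - R) \<inter> (\<Union>i<k. F i \<inter> R) = {}" by auto
      ultimately show ?thesis using finE Fi by (metis (no_types, lifting) card_Un_disjoint finite_Diff finite_UN finite_Int finite_lessThan lessThan_iff)
    qed
    ultimately have "card (E - R) + k * (card V - card (V // econn R)) < k * (card V - 1)"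
      using total by simp
    moreover have "card V - 1 = (card V - card (V // econn R)) + (card (V // econn R) - 1)"
      using pos[of "econn R"] card_FR[OF i0] by linarith
    ultimately have "card (E - R) < k * (card (V // econn R) - 1)"
      by (simp add: distrib_left)
    then show ?thesis using R(1) by blast
  qed
qed

section \<open>Sets with small boundary in graphs of large girth\<close>

text \<open>A cycle of length \<open>Suc m\<close> through the edge \<open>xy\<close> leaves a walk
  of \<open>m\<close> steps between its ends that avoids both orientations of the edge. Asking for a
  walk instead of a path spares all later uses a proof that vertices are distinct.\<close>

definition no_short_cycle :: "('a \<times> 'a) set \<Rightarrow> nat \<Rightarrow> bool" where
  "no_short_cycle E g \<longleftrightarrow>
    (\<forall>x y m. (x, y) \<in> E \<longrightarrow> (x, y) \<in> (E - {(x, y), (y, x)}) ^^ m \<longrightarrow> g \<le> Suc m)"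

text \<open>The connecting walks must stay inside \<open>B\<close>; hence they avoid every edge at a
  vertex outside \<open>B\<close>, as \<open>no_short_cycle\<close> demands.\<close>

definition diam_le :: "('a \<times> 'a) set \<Rightarrow> 'a set \<Rightarrow> nat \<Rightarrow> bool" where
  "diam_le E B d \<longleftrightarrow> (\<forall>x\<in>B. \<forall>y\<in>B. \<exists>m\<le>d. (x, y) \<in> (E \<inter> B \<times> B) ^^ m)"

lemma relpow_subset:
  fixes R S :: "('a \<times> 'a) set"
  shows "R \<subseteq> S \<Longrightarrow> (x, y) \<in> R ^^ m \<Longrightarrow> (x, y) \<in> S ^^ m"
  by (induction m arbitrary: y) auto

text \<open>Two neighbours in \<open>B\<close> would be joined inside \<open>B\<close> by at most
  \<open>d\<close> steps and close a cycle of length at most \<open>d + 2\<close> through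
  \<open>x\<close>. In \<open>no_edge_outside\<close> the detour has one more edge, hence
  \<open>d + 3\<close>.\<close>

lemma unique_nbr:
  assumes nsc: "no_short_cycle E g" and E: "sym E" and d: "diam_le E B d" "d + 2 < g"
    and x: "x \<notin> B" and y: "y1 \<in> B" "y2 \<in> B" "(x, y1) \<in> E" "(x, y2) \<in> E"
  shows "y1 = y2"
proof (rule ccontr)
  assume ne: "y1 \<noteq> y2"
  let ?S = "E - {(y1, x), (x, y1)}"
  obtain m where m: "m \<le> d" "(y1, y2) \<in> (E \<inter> B \<times> B) ^^ m"
    using d(1) y(1,2) unfolding diam_le_def by blast
  have "E \<inter> B \<times> B \<subseteq> ?S" using x by auto
  then have "(y1, y2) \<in> ?S ^^ m" using m(2) by (rule relpow_subset)
  moreover have "(y2, x) \<in> ?S" using symD[OF E y(4)] ne x y by auto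
  ultimately have "(y1, x) \<in> ?S ^^ Suc m" by auto
  moreover have "(y1, x) \<in> E" using symD[OF E y(3)] .
  ultimately have "g \<le> Suc (Suc m)" using nsc unfolding no_short_cycle_def by blast
  then show False using m(1) d(2) by simp
qed

lemma no_edge_outside:
  assumes nsc: "no_short_cycle E g" and E: "sym E" and d: "diam_le E B d" "d + 3 < g"
    and x: "x \<notin> B" "x' \<in> B" "(x, x') \<in> E" and y: "y \<notin> B" "y' \<in> B" "(y, y') \<in> E"
  shows "(x, y) \<notin> E"
proof
  assume xy: "(x, y) \<in> E"
  let ?S = "E - {(x, y), (y, x)}"
  obtain m where m: "m \<le> d" "(x', y') \<in> (E \<inter> B \<times> B) ^^ m"
    using d(1) x(2) y(2) unfolding diam_le_def by blast
  have "E \<inter> B \<times> B \<subseteq> ?S" using x by auto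
  then have "(x', y') \<in> ?S ^^ m" using m(2) by (rule relpow_subset)
  moreover have "(x, x') \<in> ?S" "(y', y) \<in> ?S" using symD[OF E y(3)] x y by auto
  ultimately have "(x, y) \<in> ?S ^^ Suc (Suc m)"
    by (meson relpow_Suc_I relpow_Suc_I2)
  then have "g \<le> Suc (Suc (Suc m))" using nsc xy unfolding no_short_cycle_def by blast
  then show False using m(1) d(2) by simp
qed

lemma diam_le_step:
  assumes E: "sym E" and d: "diam_le E B d" and L: "\<And>x. x \<in> L \<Longrightarrow> \<exists>y\<in>B. (x, y) \<in> E"
  shows "diam_le E (B \<union> L) (d + 2)"
  unfolding diam_le_def
proof (intro ballI)
  let ?S = "E \<inter> (B \<union> L) \<times> (B \<union> L)"
  have near: "\<exists>x'\<in>B. \<exists>i\<le>1. (x, x') \<in> ?S ^^ i \<and> (x', x) \<in> ?S ^^ i" if x: "x \<in> B \<union> L" for x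
  proof (cases "x \<in> B")
    case True
    then show ?thesis by (intro bexI[of _ x] exI[of _ 0]) auto
  next
    case False
    then obtain y where y: "y \<in> B" "(x, y) \<in> E" using L x by auto
    then have "(x, y) \<in> ?S" "(y, x) \<in> ?S" using symD[OF E] x by auto
    then show ?thesis using y by (intro bexI[of _ y] exI[of _ 1]) auto
  qed
  fix x y assume "x \<in> B \<union> L" "y \<in> B \<union> L"
  then obtain x' y' i j where x': "x' \<in> B" "i \<le> 1" "(x, x') \<in> ?S ^^ i"
    and y': "y' \<in> B" "j \<le> 1" "(y', y) \<in> ?S ^^ j"
    using near by metis
  obtain m where m: "m \<le> d" "(x', y') \<in> (E \<inter> B \<times> B) ^^ m"
    using d x'(1) y'(1) unfolding diam_le_def by blast
  have "(x', y') \<in> ?S ^^ m" by (rule relpow_subset[OF _ m(2)]) auto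
  then have "(x, y) \<in> ?S ^^ (i + m + j)"
    unfolding relpow_add using x'(3) y'(3) by blast
  then show "\<exists>m\<le>d + 2. (x, y) \<in> ?S ^^ m"
    using x'(2) y'(2) m(1) by (intro exI[of _ "i + m + j"]) auto
qed

section \<open>Growth of the levels around a root\<close>

definition boundary_deg :: "('a \<times> 'a) set \<Rightarrow> 'a set \<Rightarrow> 'a \<Rightarrow> nat" where
  "boundary_deg E X x = card (E `` {x} - X)"

definition next_level :: "('a \<times> 'a) set \<Rightarrow> 'a set \<Rightarrow> 'a set \<Rightarrow> 'a set" where
  "next_level E X B = {x \<in> X - B. \<exists>y\<in>B. (x, y) \<in> E}"

text \<open>Count the arcs leaving \<open>L\<close>. A vertex sends at most \<open>c\<close> of them
  into \<open>B\<close>, its boundary degree counts those leaving \<open>X\<close>, and the others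
  end in the next level, where no vertex is reached from two vertices of \<open>L\<close> because of
  \<open>unique_nbr\<close>.\<close>

lemma level_growth:
  assumes fin: "finite E" "finite X" and nsc: "no_short_cycle E g" and E: "sym E"
    and d: "diam_le E B d" "d + 2 < g" and L: "L \<subseteq> B" and B: "B \<subseteq> X"
    and deg: "\<And>x. x \<in> L \<Longrightarrow> \<delta> \<le> card (E `` {x})"
    and c: "\<And>x. x \<in> L \<Longrightarrow> card (E `` {x} \<inter> B) \<le> c"
  shows "\<delta> * card L \<le> card (next_level E X B) + c * card L + (\<Sum>x\<in>L. boundary_deg E X x)"
proof -
  have finL: "finite L" using L B fin(2) by (meson finite_subset)
  have finN: "finite (E `` {x})" for x using fin(1) by (simp add: finite_Image)
  let ?N = "\<lambda>x. E `` {x} \<inter> (X - B)"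
  have "\<delta> \<le> card (?N x) + c + boundary_deg E X x" if "x \<in> L" for x
  proof -
    have eq: "E `` {x} = (E `` {x} \<inter> B) \<union> ?N x \<union> (E `` {x} - X)" using B by auto
    then have "card (E `` {x}) \<le> card (E `` {x} \<inter> B) + card (?N x) + card (E `` {x} - X)"
      using arg_cong[OF eq, of card] card_Un_le[of "E `` {x} \<inter> B" "?N x"]
        card_Un_le[of "E `` {x} \<inter> B \<union> ?N x" "E `` {x} - X"] by linarith
    then show ?thesis using deg[OF that] c[OF that] unfolding boundary_deg_def by linarith
  qed
  then have "(\<Sum>x\<in>L. \<delta>) \<le> (\<Sum>x\<in>L. card (?N x) + c + boundary_deg E X x)" by (intro sum_mono) auto
  then have "\<delta> * card L \<le> (\<Sum>x\<in>L. card (?N x)) + c * card L + (\<Sum>x\<in>L. boundary_deg E X x)"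
    by (simp add: sum.distrib mult.commute)
  moreover have "(\<Sum>x\<in>L. card (?N x)) \<le> card (next_level E X B)"
  proof -
    have "(\<Sum>x\<in>L. card (?N x)) = card (\<Union>x\<in>L. ?N x)"
    proof (rule card_UN_disjoint[symmetric])
      show "\<forall>i\<in>L. \<forall>j\<in>L. i \<noteq> j \<longrightarrow> ?N i \<inter> ?N j = {}"
      proof (intro ballI impI, rule ccontr)
        fix i j assume ij: "i \<in> L" "j \<in> L" "i \<noteq> j" "?N i \<inter> ?N j \<noteq> {}"
        then obtain z where "z \<notin> B" "(i, z) \<in> E" "(j, z) \<in> E" by auto
        then show False using unique_nbr[OF nsc E d, of z i j] ij L symD[OF E] by auto
      qed
    qed (use finL finN in auto)
    also have "\<dots> \<le> card (next_level E X B)"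
      using fin(2) L symD[OF E] unfolding next_level_def by (intro card_mono) auto
    finally show ?thesis .
  qed
  ultimately show ?thesis by linarith
qed

text \<open>Unrolling the recursion, a boundary edge at level \<open>j\<close> costs
  \<open>q ^ (i - j)\<close> vertices at level \<open>Suc i\<close>, at most
  \<open>q ^ (i - 1)\<close>. With at most \<open>q\<close> boundary edges altogether the loss is at
  most \<open>q ^ i\<close>.\<close>

lemma level_arith:
  fixes l \<beta> :: "nat \<Rightarrow> nat"
  assumes q: "1 \<le> q" and step: "\<And>i. 1 \<le> i \<Longrightarrow> i < t \<Longrightarrow> q * l i \<le> l (Suc i) + \<beta> i"
    and b: "(\<Sum>i=1..<t. \<beta> i) \<le> q" and i: "1 \<le> i" "i < t"
  shows "l 1 * q ^ i \<le> l (Suc i) + q ^ i"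
proof -
  have *: "l 1 * q ^ i \<le> l (Suc i) + q ^ (i - 1) * (\<Sum>j=1..i. \<beta> j)" if "1 \<le> i" "i < t" for i
    using that
  proof (induction i rule: nat_induct_at_least)
    case base
    then show ?case using step[of 1] by (simp add: mult.commute)
  next
    case (Suc i)
    have "l 1 * q ^ Suc i = q * (l 1 * q ^ i)" by (simp add: algebra_simps)
    also have "\<dots> \<le> q * (l (Suc i) + q ^ (i - 1) * (\<Sum>j=1..i. \<beta> j))"
      using Suc.IH Suc.prems by (intro mult_left_mono) auto
    also have "\<dots> = q * l (Suc i) + q ^ i * (\<Sum>j=1..i. \<beta> j)"
      using Suc.hyps by (cases i) (simp_all add: algebra_simps)
    also have "\<dots> \<le> l (Suc (Suc i)) + \<beta> (Suc i) + q ^ i * (\<Sum>j=1..i. \<beta> j)"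
      using step[of "Suc i"] Suc.prems by simp
    also have "\<dots> \<le> l (Suc (Suc i)) + q ^ i * \<beta> (Suc i) + q ^ i * (\<Sum>j=1..i. \<beta> j)"
      using q by simp
    finally show ?case using Suc.hyps by (simp add: algebra_simps)
  qed
  have "(\<Sum>j=1..i. \<beta> j) \<le> (\<Sum>j=1..<t. \<beta> j)" using i by (intro sum_mono2) auto
  then have "q ^ (i - 1) * (\<Sum>j=1..i. \<beta> j) \<le> q ^ (i - 1) * q" using b by (intro mult_left_mono) auto
  also have "\<dots> = q ^ i" using i by (simp add: power_eq_if)
  finally show ?thesis using *[OF i] by simp
qed

text \<open>
  The root \<open>C\<close> is a vertex (\<open>r = 0\<close>, odd girth) or an edge (\<open>r = 1\<close>, even girth); \<open>l i\<close> is the size of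
  the \<open>i\<close>-th level around it. Boundary edges cost most at level 1, which is why \<open>q ^ i\<close> is lost.
\<close>

lemma ball_card_bound:
  assumes fin: "finite E" "finite X" and nsc: "no_short_cycle E g" and E: "sym E"
    and q: "1 \<le> q" and deg: "\<And>x. x \<in> X \<Longrightarrow> Suc q \<le> card (E `` {x})"
    and bd: "(\<Sum>x\<in>X. boundary_deg E X x) \<le> q"
    and C: "C \<subseteq> X" "diam_le E C r" "card C = Suc r" "\<And>x. x \<in> C \<Longrightarrow> boundary_deg E X x = 0"
      "\<And>x. x \<in> C \<Longrightarrow> card (E `` {x} \<inter> C) \<le> r"
    and t: "1 \<le> t" "2 * t + r < g"
  shows "\<exists>l. Suc r + (\<Sum>i=1..t. l i) \<le> card X \<and> Suc r * Suc q \<le> l 1 + r * Suc r \<and>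
    (\<forall>i. 1 \<le> i \<longrightarrow> i < t \<longrightarrow> l 1 * q ^ i \<le> l (Suc i) + q ^ i)"
proof -
  define B where "B = rec_nat C (\<lambda>_ B. B \<union> next_level E X B)"
  have B0: "B 0 = C" and BS: "B (Suc i) = B i \<union> next_level E X (B i)" for i
    unfolding B_def by auto
  define L where "L i = next_level E X (B (i - 1))" for i
  have BX: "B i \<subseteq> X" for i
    by (induction i) (auto simp: B0 BS next_level_def C(1) dest: subsetD[OF C(1)])
  have finB: "finite (B i)" for i using BX fin(2) finite_subset by blast
  have L_nbr: "\<exists>y\<in>B i. (x, y) \<in> E" if "x \<in> L (Suc i)" for x i
    using that unfolding L_def next_level_def by auto
  have L_disj: "B i \<inter> L (Suc i) = {}" for i
    unfolding L_def next_level_def by auto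
  have BSL: "B (Suc i) = B i \<union> L (Suc i)" for i unfolding L_def by (simp add: BS)
  have finL: "finite (L i)" for i unfolding L_def next_level_def using fin(2) by auto
  have diam: "diam_le E (B i) (2 * i + r)" for i
  proof (induction i)
    case (Suc i)
    show ?case using diam_le_step[OF E Suc L_nbr] unfolding BSL by simp
  qed (simp add: B0 C)
  define l where "l i = card (L i)" for i
  define \<beta> where "\<beta> i = (\<Sum>x\<in>L i. boundary_deg E X x)" for i
  have cardB: "card (B i) = Suc r + (\<Sum>j=1..i. l j)" for i
  proof (induction i)
    case (Suc i)
    have "card (B (Suc i)) = card (B i) + card (L (Suc i))"
      unfolding BSL using card_Un_disjoint[OF finB finL L_disj] .
    then show ?case using Suc unfolding l_def by simp
  qed (simp add: B0 C)
  \<comment> \<open>No arc of the root leaves \<open>X\<close>, so only the at most \<open>r\<close>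
    neighbours inside the root are subtracted per root vertex.\<close>
  have l1: "Suc r * Suc q \<le> l 1 + r * Suc r"
  proof -
    have "Suc q * card C \<le> card (next_level E X C) + r * card C + (\<Sum>x\<in>C. boundary_deg E X x)"
      using C t deg by (intro level_growth[OF fin nsc E C(2)]) auto
    then show ?thesis using C(3,4) unfolding l_def L_def by (simp add: B0 algebra_simps)
  qed
  have step: "q * l i \<le> l (Suc i) + \<beta> i" if i: "1 \<le> i" "i < t" for i
  proof -
    obtain j where j: "i = Suc j" using i by (cases i) auto
    \<comment> \<open>The parent is the only neighbour in the ball \<open>B j\<close> by
      \<open>unique_nbr\<close>, and \<open>no_edge_outside\<close> excludes edges within the level.
      The case \<open>i = t\<close> is left out because the girth does not control the last
      level.\<close>
    have inner: "card (E `` {x} \<inter> B i) \<le> 1" if x: "x \<in> L i" for x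
    proof -
      obtain x' where x': "x' \<in> B j" "(x, x') \<in> E" using L_nbr x j by auto
      have xB: "x \<notin> B j" using L_disj[of j] x j by auto
      have "E `` {x} \<inter> B i \<subseteq> {x'}"
      proof
        fix y assume y: "y \<in> E `` {x} \<inter> B i"
        show "y \<in> {x'}"
        proof (cases "y \<in> B j")
          case True
          then show ?thesis
            using unique_nbr[OF nsc E diam[of j] _ xB True x'(1)] y x' i t j by auto
        next
          case False
          then have "y \<in> L (Suc j)" using y j BSL by auto
          then obtain y' where "y' \<in> B j" "(y, y') \<in> E" using L_nbr by auto
          then show ?thesis
            using no_edge_outside[OF nsc E diam[of j] _ xB x' False] y i t j by auto
        qed
      qed
      then show ?thesis by (metis card.empty card_mono card_insert_disjoint empty_iff finite.emptyI finite_insert One_nat_def)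
    qed
    have LB: "L i \<subseteq> B i" using j BSL by auto
    have "Suc q * card (L i) \<le> card (next_level E X (B i)) + 1 * card (L i) + (\<Sum>x\<in>L i. boundary_deg E X x)"
      using LB BX deg inner i t by (intro level_growth[OF fin nsc E diam]) auto
    then show ?thesis unfolding l_def \<beta>_def L_def by simp
  qed
  \<comment> \<open>The levels are disjoint subsets of \<open>X\<close>, so their losses together
    are at most the boundary of \<open>X\<close>.\<close>
  have "(\<Sum>i=1..<t. \<beta> i) = (\<Sum>x\<in>(\<Union>i\<in>{1..<t}. L i). boundary_deg E X x)"
    unfolding \<beta>_def
  proof (rule sum.UNION_disjoint[symmetric])
    have mono: "B i \<subseteq> B j" if "i \<le> j" for i j using that by (induction rule: dec_induct) (auto simp: BS)
    have "L i \<inter> L j = {}" if ij: "1 \<le> i" "i < j" for i j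
    proof -
      obtain j' where j': "j = Suc j'" using ij by (cases j) auto
      obtain i' where i': "i = Suc i'" using ij by (cases i) auto
      have "L i \<subseteq> B j'" using BSL[of i'] mono[of i j'] ij i' j' by auto
      then show ?thesis using L_disj[of j'] j' by auto
    qed
    then show "\<forall>i\<in>{1..<t}. \<forall>j\<in>{1..<t}. i \<noteq> j \<longrightarrow> L i \<inter> L j = {}"
      by (metis atLeastLessThan_iff inf_commute linorder_neqE_nat)
  qed (use finL in auto)
  also have "\<dots> \<le> (\<Sum>x\<in>X. boundary_deg E X x)"
    using fin(2) unfolding L_def next_level_def by (intro sum_mono2) auto
  finally have "(\<Sum>i=1..<t. \<beta> i) \<le> q" using bd by simp
  then have "l 1 * q ^ i \<le> l (Suc i) + q ^ i" if "1 \<le> i" "i < t" for i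
    using level_arith[where l = l and \<beta> = \<beta>, OF q step _ that] by blast
  moreover have "Suc r + (\<Sum>i=1..t. l i) \<le> card X"
    using cardB[of t] card_mono[OF fin(2) BX[of t]] by simp
  ultimately show ?thesis using l1 by blast
qed

lemma exists_interior_vertex:
  assumes "finite X" "S \<subseteq> X" "(\<Sum>x\<in>X. boundary_deg E X x) < card S"
  shows "\<exists>x\<in>S. boundary_deg E X x = 0"
proof (rule ccontr)
  assume "\<not> ?thesis"
  then have "(\<Sum>x\<in>S. 1) \<le> (\<Sum>x\<in>S. boundary_deg E X x)" by (intro sum_mono) (auto simp: Suc_le_eq)
  also have "\<dots> \<le> (\<Sum>x\<in>X. boundary_deg E X x)" using assms by (intro sum_mono2) auto
  finally show False using assms(3) by simp
qed

text \<open>With \<open>s\<close> vertices, each has at most \<open>s - 1\<close> neighbours inside,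
  so the boundary has at least \<open>s * (q + 2 - s)\<close> edges, which exceeds \<open>q\<close>
  for \<open>1 \<le> s \<le> q\<close>. Having more vertices than boundary edges yields a vertex
  without boundary edges, the root of the level count.\<close>

lemma small_boundary_card_gt:
  assumes fin: "finite E" "finite X" and irr: "irrefl E" and X: "X \<noteq> {}"
    and deg: "\<And>x. x \<in> X \<Longrightarrow> Suc q \<le> card (E `` {x})"
    and bd: "(\<Sum>x\<in>X. boundary_deg E X x) \<le> q"
  shows "q < card X"
proof (rule ccontr)
  assume "\<not> ?thesis"
  moreover define s where "s = card X"
  ultimately have s: "s \<le> q" "1 \<le> s" using X fin by (auto simp: Suc_le_eq card_gt_0_iff)
  have "Suc q \<le> boundary_deg E X x + (s - 1)" if x: "x \<in> X" for x
  proof -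
    have "E `` {x} \<subseteq> (E `` {x} - X) \<union> (X - {x})" using irr by (auto simp: irrefl_def)
    then have "card (E `` {x}) \<le> card ((E `` {x} - X) \<union> (X - {x}))"
      using fin by (intro card_mono) auto
    also have "\<dots> \<le> card (E `` {x} - X) + card (X - {x})" by (rule card_Un_le)
    finally show ?thesis using deg[OF x] x fin unfolding boundary_deg_def s_def by simp
  qed
  then have "(\<Sum>x\<in>X. Suc q) \<le> (\<Sum>x\<in>X. boundary_deg E X x + (s - 1))" by (intro sum_mono) auto
  then have "s * Suc q \<le> q + s * (s - 1)"
    using bd by (simp add: sum.distrib s_def)
  moreover obtain p where p: "s = Suc p" using s by (cases s) auto
  ultimately have "p * q + 1 \<le> p * p" by (simp add: algebra_simps)
  moreover have "p * p \<le> p * q" using s p by (intro mult_le_mono2) simp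
  ultimately show False by simp
qed

text \<open>Here the formula for \<open>n1_star\<close> comes out. For a vertex root,
  \<open>l 1 \<ge> q + 1\<close> and the loss of \<open>q ^ i\<close> leaves
  \<open>l (Suc i) \<ge> q ^ Suc i\<close>. For an edge root, \<open>l 1 \<ge> 2 * q\<close> leaves
  \<open>2 * q ^ Suc i - q ^ i\<close>, and summing over the levels cancels one copy of every power
  except the last.\<close>

lemma n1_star_le:
  fixes l :: "nat \<Rightarrow> nat"
  assumes q: "\<delta> = Suc q" "1 \<le> q" and t: "1 \<le> t" and r: "r \<le> 1" and g: "g = 2 * t + r + 1"
    and l1: "Suc r * \<delta> \<le> l 1 + r * Suc r"
    and l: "\<And>i. 1 \<le> i \<Longrightarrow> i < t \<Longrightarrow> l 1 * q ^ i \<le> l (Suc i) + q ^ i"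
  shows "n1_star \<delta> g \<le> Suc r + (\<Sum>i=1..t. l i)"
proof (cases "r = 0")
  case True
  have l1': "Suc q \<le> l 1" using l1 q True by simp
  have "q ^ i \<le> l i" if i: "2 \<le> i" "i \<le> t" for i
  proof -
    obtain j where j: "i = Suc j" "1 \<le> j" "j < t" using i by (cases i) auto
    have "Suc q * q ^ j \<le> l 1 * q ^ j" using l1' by (rule mult_le_mono1)
    then show ?thesis using l[OF j(2,3)] j(1) by simp
  qed
  then have "(\<Sum>i=2..t. q ^ i) \<le> (\<Sum>i=2..t. l i)" by (intro sum_mono) auto
  moreover have "(\<Sum>i=1..t. l i) = l 1 + (\<Sum>i=2..t. l i)"
    using t by (simp add: sum.atLeast_Suc_atMost numeral_2_eq_2)
  ultimately show ?thesis using True g q l1' unfolding n1_star_def Let_def by simp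
next
  case False
  with r have r1: "r = 1" by simp
  have l1': "2 * q \<le> l 1" using l1 q r1 by simp
  have l2: "2 * q ^ Suc j \<le> l (Suc j) + q ^ j" if "1 \<le> j" "j < t" for j
  proof -
    have "2 * q * q ^ j \<le> l 1 * q ^ j" using l1' by (rule mult_le_mono1)
    moreover have "2 * q * q ^ j = 2 * q ^ Suc j" by simp
    ultimately show ?thesis using l[OF that] by linarith
  qed
  have ind: "2 * q ^ s + (\<Sum>i=1..s - 1. q ^ i) \<le> (\<Sum>i=1..s. l i)" if "1 \<le> s" "s \<le> t" for s
    using that
  proof (induction s rule: nat_induct_at_least)
    case base
    then show ?case using l1' by simp
  next
    case (Suc s)
    have "(\<Sum>i=1..Suc s - 1. q ^ i) = (\<Sum>i=1..s - 1. q ^ i) + q ^ s"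
      using Suc.hyps by (cases s) auto
    moreover have "2 * q ^ Suc s \<le> l (Suc s) + q ^ s" using l2[of s] Suc by simp
    ultimately show ?case using Suc by simp
  qed
  show ?thesis using ind[of t] t r1 g q unfolding n1_star_def Let_def by simp
qed

lemma small_boundary_imp_large:
  assumes fin: "finite E" "finite X" and sym: "sym E" and irr: "irrefl E"
    and nsc: "no_short_cycle E g" and g: "3 \<le> g" and X: "X \<noteq> {}" and \<delta>: "2 \<le> \<delta>"
    and deg: "\<And>x. x \<in> X \<Longrightarrow> \<delta> \<le> card (E `` {x})"
    and bd: "(\<Sum>x\<in>X. boundary_deg E X x) < \<delta>"
  shows "n1_star \<delta> g \<le> card X"
proof -
  define q where "q = \<delta> - 1"
  have q: "\<delta> = Suc q" "1 \<le> q" using \<delta> unfolding q_def by auto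
  have bd': "(\<Sum>x\<in>X. boundary_deg E X x) \<le> q" using bd q by simp
  have deg': "\<And>x. x \<in> X \<Longrightarrow> Suc q \<le> card (E `` {x})" using deg q by simp
  have "q < card X" by (rule small_boundary_card_gt[OF fin irr X deg' bd'])
  then obtain u where u: "u \<in> X" "boundary_deg E X u = 0"
    using exists_interior_vertex[OF fin(2) order_refl, of E] bd' by auto
  have finN: "finite (E `` {x})" for x using fin(1) by (simp add: finite_Image)
  have uX: "E `` {u} \<subseteq> X" using u(2) finN unfolding boundary_deg_def by auto
  define t where "t = (g - 1) div 2"
  have t: "1 \<le> t" using g unfolding t_def by simp
  have loop: "(x, x) \<notin> E" for x using irr by (simp add: irrefl_def)
  show ?thesis
  proof (cases "odd g")
    case True
    then have gt: "g = 2 * t + 0 + 1" using g unfolding t_def by presburger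
    have "\<exists>l. Suc 0 + (\<Sum>i=1..t. l i) \<le> card X \<and> Suc 0 * Suc q \<le> l 1 + 0 * Suc 0 \<and>
        (\<forall>i. 1 \<le> i \<longrightarrow> i < t \<longrightarrow> l 1 * q ^ i \<le> l (Suc i) + q ^ i)"
    proof (rule ball_card_bound[OF fin nsc sym q(2) deg' bd', of "{u}"])
      show "diam_le E {u} 0" unfolding diam_le_def by simp
    qed (use u t gt loop in auto)
    then obtain l where l: "Suc 0 + (\<Sum>i=1..t. l i) \<le> card X" "Suc 0 * Suc q \<le> l 1 + 0 * Suc 0"
      "\<And>i. 1 \<le> i \<Longrightarrow> i < t \<Longrightarrow> l 1 * q ^ i \<le> l (Suc i) + q ^ i" by blast
    have "n1_star \<delta> g \<le> Suc 0 + (\<Sum>i=1..t. l i)"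
      by (rule n1_star_le[where l = l, OF q t _ gt _ l(3)]) (use l(2) q(1) in auto)
    then show ?thesis using l(1) by simp
  next
    case False
    then have gt: "g = 2 * t + 1 + 1" using g unfolding t_def by presburger
    \<comment> \<open>All neighbours of \<open>u\<close> lie in \<open>X\<close>, and there are more
      of them than boundary edges; hence one of them has no boundary edge either and completes the
      root edge.\<close>
    have "q < card (E `` {u})" using deg'[OF u(1)] by simp
    then obtain v where v: "v \<in> E `` {u}" "boundary_deg E X v = 0"
      using exists_interior_vertex[OF fin(2) uX, of E] bd' by auto
    have uv: "(u, v) \<in> E" "(v, u) \<in> E" "u \<noteq> v" using v(1) symD[OF sym] loop by auto
    have Nu: "E `` {u} \<inter> {u, v} = {v}" and Nv: "E `` {v} \<inter> {u, v} = {u}" using uv loop by auto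
    have "\<exists>l. Suc 1 + (\<Sum>i=1..t. l i) \<le> card X \<and> Suc 1 * Suc q \<le> l 1 + 1 * Suc 1 \<and>
        (\<forall>i. 1 \<le> i \<longrightarrow> i < t \<longrightarrow> l 1 * q ^ i \<le> l (Suc i) + q ^ i)"
    proof (rule ball_card_bound[OF fin nsc sym q(2) deg' bd', of "{u, v}"])
      have "(x, y) \<in> (E \<inter> {u, v} \<times> {u, v}) ^^ (if x = y then 0 else 1)" if "x \<in> {u, v}" "y \<in> {u, v}" for x y
        using that uv by auto
      moreover have "(if x = y then 0 else 1) \<le> (1::nat)" for x y :: 'a by simp
      ultimately show "diam_le E {u, v} 1" unfolding diam_le_def by blast
      show "card (E `` {x} \<inter> {u, v}) \<le> 1" if "x \<in> {u, v}" for x using that Nu Nv by auto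
    qed (use u v uX uv t gt in auto)
    then obtain l where l: "Suc 1 + (\<Sum>i=1..t. l i) \<le> card X" "Suc 1 * Suc q \<le> l 1 + 1 * Suc 1"
      "\<And>i. 1 \<le> i \<Longrightarrow> i < t \<Longrightarrow> l 1 * q ^ i \<le> l (Suc i) + q ^ i" by blast
    have "n1_star \<delta> g \<le> Suc 1 + (\<Sum>i=1..t. l i)"
      by (rule n1_star_le[where l = l, OF q t _ gt _ l(3)]) (use l(2) q(1) in auto)
    then show ?thesis using l(1) by simp
  qed
qed

lemma n1_star_pos: "0 < n1_star \<delta> g"
  unfolding n1_star_def Let_def by simp

section \<open>Boundaries of the parts of a partition\<close>

definition bdry :: "('a \<times> 'a) set \<Rightarrow> 'a set \<Rightarrow> nat" where
  "bdry E X = card (E \<inter> X \<times> - X)"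

lemma bdry_eq_sum:
  assumes "finite E" "finite X"
  shows "bdry E X = (\<Sum>x\<in>X. boundary_deg E X x)"
proof -
  have "E \<inter> X \<times> - X = (SIGMA x:X. E `` {x} - X)" by auto
  then show ?thesis unfolding bdry_def boundary_deg_def
    using assms by (simp add: card_SigmaI finite_Image)
qed

text \<open>
  Take \<open>X\<close> with minimal boundary. If every other part \<open>Y\<close> violated the bound, then summing over \<open>Y\<close>
  would contradict the hypothesis, since the edges from \<open>X\<close> to the other parts are its boundary.
\<close>

lemma two_parts:
  fixes E :: "('a \<times> 'a) set"
  assumes fin: "finite E" "finite \<P>" and ne: "\<P> \<noteq> {}" and disj: "\<And>X Y. X \<in> \<P> \<Longrightarrow> Y \<in> \<P> \<Longrightarrow> X \<noteq> Y \<Longrightarrow> X \<inter> Y = {}"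
    and cover: "E \<subseteq> \<Union>\<P> \<times> \<Union>\<P>"
    and few: "(\<Sum>X\<in>\<P>. bdry E X) < 2 * k * (card \<P> - 1)"
  obtains X Y where "X \<in> \<P>" "Y \<in> \<P>" "X \<noteq> Y"
    "bdry E X + card (E \<inter> X \<times> Y) < 2 * k" "bdry E Y + card (E \<inter> X \<times> Y) < 2 * k"
proof -
  obtain X where X: "X \<in> \<P>" and min: "\<And>Y. Y \<in> \<P> \<Longrightarrow> bdry E X \<le> bdry E Y"
    using ex_min_if_finite[of "bdry E ` \<P>"] fin(2) ne by (force simp: not_less)
  have "\<exists>Y\<in>\<P> - {X}. bdry E Y + card (E \<inter> X \<times> Y) < 2 * k"
  proof (rule ccontr)
    assume "\<not> ?thesis"
    then have "(\<Sum>Y\<in>\<P> - {X}. 2 * k) \<le> (\<Sum>Y\<in>\<P> - {X}. bdry E Y + card (E \<inter> X \<times> Y))"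
      by (intro sum_mono) (auto simp: not_less)
    then have "2 * k * (card \<P> - 1) \<le> (\<Sum>Y\<in>\<P> - {X}. bdry E Y) + (\<Sum>Y\<in>\<P> - {X}. card (E \<inter> X \<times> Y))"
      using X fin(2) by (simp add: sum.distrib card_Diff_singleton algebra_simps)
    also have "(\<Sum>Y\<in>\<P> - {X}. card (E \<inter> X \<times> Y)) = card (\<Union>Y\<in>\<P> - {X}. E \<inter> X \<times> Y)"
    proof (rule card_UN_disjoint[symmetric])
      show "\<forall>Y\<in>\<P> - {X}. \<forall>Z\<in>\<P> - {X}. Y \<noteq> Z \<longrightarrow> E \<inter> X \<times> Y \<inter> (E \<inter> X \<times> Z) = {}"
      proof (intro ballI impI)
        fix Y Z assume "Y \<in> \<P> - {X}" "Z \<in> \<P> - {X}" "Y \<noteq> Z"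
        then have "Y \<inter> Z = {}" using disj by simp
        then show "E \<inter> X \<times> Y \<inter> (E \<inter> X \<times> Z) = {}" by auto
      qed
    qed (use fin in auto)
    also have "(\<Union>Y\<in>\<P> - {X}. E \<inter> X \<times> Y) = E \<inter> X \<times> - X"
    proof (intro equalityI subsetI)
      fix e assume "e \<in> (\<Union>Y\<in>\<P> - {X}. E \<inter> X \<times> Y)"
      then obtain Y where "Y \<in> \<P>" "Y \<noteq> X" "e \<in> E" "e \<in> X \<times> Y" by auto
      then show "e \<in> E \<inter> X \<times> - X" using disj[OF X, of Y] by auto
    next
      fix e assume "e \<in> E \<inter> X \<times> - X"
      then show "e \<in> (\<Union>Y\<in>\<P> - {X}. E \<inter> X \<times> Y)" using cover by fastforce
    qed
    also have "card (E \<inter> X \<times> - X) = bdry E X" unfolding bdry_def ..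
    finally show False using few X fin(2) by (simp add: sum.remove)
  qed
  then obtain Y where Y: "Y \<in> \<P>" "Y \<noteq> X" "bdry E Y + card (E \<inter> X \<times> Y) < 2 * k" by auto
  show thesis using that[OF X Y(1)] Y min[OF Y(1)] by auto
qed

text \<open>\<open>E\<close> holds both arcs of an edge and \<open>bdry\<close> counts outgoing
  arcs, so a crossing edge contributes once to each of the two classes it joins. No edge of
  \<open>R\<close> crosses, because its ends are equivalent; \<open>E0 - R\<close> may also contain
  edges inside a class, hence an inequality.\<close>

lemma sum_bdry_quotient_le:
  fixes E E0 :: "('a \<times> 'a) set"
  assumes fin: "finite E" "finite V" "finite E0" and E0: "E = E0 \<union> E0\<inverse>" "E \<subseteq> V \<times> V"
  shows "(\<Sum>X\<in>V // econn R. bdry E X) \<le> 2 * card (E0 - R)"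
proof -
  have finQ: "finite (V // econn R)" using fin(2) unfolding quotient_def by simp
  have disj: "X \<inter> Y = {}" if "X \<in> V // econn R" "Y \<in> V // econn R" "X \<noteq> Y" for X Y
    using quotient_disj[OF equiv_econn[of R], of X Y] that
    by (metis quotientE quotientI UNIV_I)
  have "(\<Sum>X\<in>V // econn R. bdry E X) = card (\<Union>X\<in>V // econn R. E \<inter> X \<times> - X)"
    unfolding bdry_def
  proof (rule card_UN_disjoint[symmetric])
    show "\<forall>X\<in>V // econn R. \<forall>Y\<in>V // econn R. X \<noteq> Y \<longrightarrow> E \<inter> X \<times> - X \<inter> (E \<inter> Y \<times> - Y) = {}"
    proof (intro ballI impI)
      fix X Y assume "X \<in> V // econn R" "Y \<in> V // econn R" "X \<noteq> Y"
      then have "X \<inter> Y = {}" by (rule disj)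
      then show "E \<inter> X \<times> - X \<inter> (E \<inter> Y \<times> - Y) = {}" by auto
    qed
  qed (use fin finQ in auto)
  also have "\<dots> \<le> card ((E0 - R) \<union> (E0 - R)\<inverse>)"
  proof (rule card_mono)
    show "(\<Union>X\<in>V // econn R. E \<inter> X \<times> - X) \<subseteq> (E0 - R) \<union> (E0 - R)\<inverse>"
    proof
      fix e assume "e \<in> (\<Union>X\<in>V // econn R. E \<inter> X \<times> - X)"
      then obtain X x y where e: "e = (x, y)" "(x, y) \<in> E" and X: "X \<in> V // econn R" "x \<in> X" "y \<notin> X"
        by (cases e) auto
      obtain v where v: "X = econn R `` {v}" using X(1) by (rule quotientE)
      have "(x, y) \<notin> econn R" using X(2,3) econn_trans[of v x R y] unfolding v by auto
      then have "(x, y) \<notin> R" "(y, x) \<notin> R" using subset_econn[of R] econn_sym[of y x R] by auto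
      then show "e \<in> (E0 - R) \<union> (E0 - R)\<inverse>" using e E0(1) by auto
    qed
  qed (use fin in auto)
  also have "\<dots> \<le> card (E0 - R) + card ((E0 - R)\<inverse>)" by (rule card_Un_le)
  finally show ?thesis by (simp add: card_inverse)
qed

section \<open>Cycles and trees in the graph library\<close>

lemma pcas_walk: "pcas (f 0) (map (\<lambda>i. (f i, f (Suc i))) [0..<m]) (f m)"
proof (induction m arbitrary: f)
  case (Suc m)
  have "map (\<lambda>i. (f i, f (Suc i))) [0..<Suc m] = (f 0, f 1) # map (\<lambda>i. (f (Suc i), f (Suc (Suc i)))) [0..<m]"
    by (simp add: upt_conv_Cons map_Suc_upt[symmetric] del: upt_Suc)
  then show ?case using Suc[of "\<lambda>i. f (Suc i)"] by simp
qed simp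

lemma pawalk_verts_walk: "pawalk_verts (f 0) (map (\<lambda>i. (f i, f (Suc i))) [0..<m]) = map f [0..<Suc m]"
proof (induction m arbitrary: f)
  case (Suc m)
  have "map (\<lambda>i. (f i, f (Suc i))) [0..<Suc m] = (f 0, f 1) # map (\<lambda>i. (f (Suc i), f (Suc (Suc i)))) [0..<m]"
    by (simp add: upt_conv_Cons map_Suc_upt[symmetric] del: upt_Suc)
  moreover have "map f [0..<Suc (Suc m)] = f 0 # map (\<lambda>i. f (Suc i)) [0..<Suc m]"
    by (simp add: upt_conv_Cons map_Suc_upt[symmetric] del: upt_Suc)
  ultimately show ?case using Suc[of "\<lambda>i. f (Suc i)"] by simp
qed simp

text \<open>A shortest walk from \<open>x\<close> to \<open>y\<close> avoiding the edge repeats no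
  vertex, since cutting out the part between two visits would shorten it. Closed up by the arc
  \<open>(y, x)\<close> it is a cycle.\<close>

lemma girth_imp_no_short_cycle:
  assumes G: "pair_graph G" and g: "enat g \<le> girth G"
  shows "no_short_cycle (parcs G) g"
  unfolding no_short_cycle_def
proof (intro allI impI)
  interpret pair_graph G by fact
  fix x y m
  let ?S = "parcs G - {(x, y), (y, x)}"
  assume xy: "(x, y) \<in> parcs G" and walk: "(x, y) \<in> ?S ^^ m"
  define k where "k = (LEAST m. (x, y) \<in> ?S ^^ m)"
  have k: "(x, y) \<in> ?S ^^ k" unfolding k_def using walk by (rule LeastI)
  have km: "k \<le> m" unfolding k_def using walk by (rule Least_le)
  have min: "k \<le> j" if "(x, y) \<in> ?S ^^ j" for j unfolding k_def using that by (rule Least_le)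
  obtain f where f: "f 0 = x" "f k = y" "\<And>i. i < k \<Longrightarrow> (f i, f (Suc i)) \<in> ?S"
    using k unfolding relpow_fun_conv by auto
  have part: "(f i, f (i + j)) \<in> ?S ^^ j" if "i + j \<le> k" for i j
  proof -
    have "(f (i + l), f (i + Suc l)) \<in> ?S" if "l < j" for l
      using f(3)[of "i + l"] \<open>i + j \<le> k\<close> that by (simp del: Diff_insert)
    then show ?thesis unfolding relpow_fun_conv by (intro exI[of _ "\<lambda>l. f (i + l)"]) simp
  qed
  have "inj_on f {0..<Suc k}"
  proof (rule linorder_inj_onI')
    fix i j assume ij: "i \<in> {0..<Suc k}" "j \<in> {0..<Suc k}" "i < j"
    show "f i \<noteq> f j"
    proof
      assume eq: "f i = f j"
      have "(x, f i) \<in> ?S ^^ i" using part[of 0 i] ij f(1) by simp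
      moreover have "(f i, y) \<in> ?S ^^ (k - j)" using part[of j "k - j"] ij f(2) eq by simp
      ultimately have "(x, y) \<in> ?S ^^ (i + (k - j))" unfolding relpow_add by blast
      from min[OF this] show False using ij by simp
    qed
  qed
  then have dist: "distinct (map f [0..<Suc k])" by (simp add: distinct_map del: upt_Suc)
  have "x \<noteq> y" using no_loops'[OF xy] .
  \<comment> \<open>Zero steps would give \<open>x = y\<close>, and a single step would be the
    removed arc. So the cycle has at least three arcs, as \<open>ucycle\<close> requires.\<close>
  have "k \<noteq> 0" using k \<open>x \<noteq> y\<close> by (intro notI) simp
  moreover have "k \<noteq> 1" using k by (intro notI) simp
  ultimately have k2: "2 \<le> k" by simp
  define p where "p = (y, x) # map (\<lambda>i. (f i, f (Suc i))) [0..<k]"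
  have len: "length p = Suc k" unfolding p_def by simp
  have "pcas y p y" unfolding p_def using pcas_walk[of f k] f(1,2) by simp
  moreover have "set p \<subseteq> parcs G" unfolding p_def using f(3) arcs_symmetric[OF xy] by auto
  moreover have "tl (pawalk_verts y p) = map f [0..<Suc k]"
    unfolding p_def using pawalk_verts_walk[of f k] f(1) by simp
  ultimately have "ucycle G p"
    unfolding ucycle_def cycle_def awalk_def using dist len k2 in_arcsD2[OF xy] by auto
  then have "girth G \<le> enat (length p)" unfolding girth_def by (intro INF_lower) simp
  with g have "enat g \<le> enat (length p)" by (rule order_trans)
  then show "g \<le> Suc m" using len km by simp
qed

section \<open>Spanning forests as edge-disjoint spanning trees\<close>

lemma pcas_imp_rtrancl: "pcas u p v \<Longrightarrow> set p \<subseteq> T \<Longrightarrow> (u, v) \<in> T\<^sup>*"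
proof (induction p arbitrary: u)
  case (Cons e p)
  then have "(u, snd e) \<in> T" by (cases e) auto
  then show ?case using Cons by (auto intro: converse_rtrancl_into_rtrancl)
qed simp

lemma pcas_last_in_verts: "pcas u p v \<Longrightarrow> v \<in> set (pawalk_verts u p)"
  by (induction p arbitrary: u) auto

lemma pcas_arc_ends_in_verts:
  "pcas u p v \<Longrightarrow> (x, y) \<in> set p \<Longrightarrow> x \<in> set (pawalk_verts u p) \<and> y \<in> set (pawalk_verts u p)"
proof (induction p arbitrary: u)
  case (Cons e p)
  have "snd e \<in> set (pawalk_verts (snd e) p)" by (cases p) (use Cons.prems in auto)
  then show ?case using Cons by auto
qed simp

lemma distinct_path_arc_into_start:
  "pcas u p v \<Longrightarrow> distinct (pawalk_verts u p) \<Longrightarrow> (x, u) \<notin> set p"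
proof (induction p arbitrary: u)
  case (Cons e p)
  have "snd e \<in> set (pawalk_verts (snd e) p)" by (cases p) (use Cons.prems in auto)
  then show ?case using Cons.prems pcas_arc_ends_in_verts[of "snd e" p v x u] by (cases e) auto
qed simp

lemma distinct_path_arc_start_end:
  assumes "pcas u p v" "distinct (pawalk_verts u p)" "(u, v) \<in> set p"
  shows "length p = 1"
proof (cases p)
  case (Cons e q)
  have "(u, v) \<notin> set q" using assms pcas_arc_ends_in_verts[of "snd e" q v u v] Cons by auto
  then have e: "e = (u, v)" using assms(3) Cons by auto
  have "q = []"
  proof (rule ccontr)
    assume "q \<noteq> []"
    then obtain e' q' where q: "q = e' # q'" by (cases q) auto
    then have "fst e' = v" "pcas (snd e') q' v" using assms(1) Cons e by auto
    then show False using assms(2) Cons q pcas_last_in_verts[of "snd e'" q' v] by auto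
  qed
  then show ?thesis using Cons by simp
qed (use assms in simp)

text \<open>Cut the cycle at its first arc. The remaining path has distinct vertices and at least
  two arcs, so it uses that edge in neither direction; the edge then lies in the closure of the
  other edges of \<open>S\<close>.\<close>

lemma eforest_no_ucycle:
  assumes S: "eforest S" and H: "parcs H = S \<union> S\<inverse>"
  shows "\<not> ucycle H p"
proof
  assume "ucycle H p"
  then obtain a where walk: "pcas a p a" "set p \<subseteq> S \<union> S\<inverse>" "distinct (tl (pawalk_verts a p))"
    and len: "3 \<le> length p"
    unfolding ucycle_def pre_digraph.cycle_def pre_digraph.awalk_def
    by (auto simp: cas_with_proj_eq awalk_verts_with_proj_eq H)
  obtain e q where p: "p = e # q" using len by (cases p) auto
  obtain b where e: "e = (a, b)" using walk(1) p by (cases e) auto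
  have q: "pcas b q a" "distinct (pawalk_verts b q)" using walk p e by auto
  have "(a, b) \<notin> set q" by (rule distinct_path_arc_into_start[OF q])
  moreover have "(b, a) \<notin> set q" using distinct_path_arc_start_end[OF q] len p by auto
  ultimately have "set q \<subseteq> (S \<union> S\<inverse>) - {(a, b), (b, a)}" using walk(2) p by auto
  then have "set q \<subseteq> (S - {f}) \<union> (S - {f})\<inverse>" if "f = (a, b) \<or> f = (b, a)" for f using that by auto
  from pcas_imp_rtrancl[OF q(1) this] have ba: "(b, a) \<in> econn (S - {f})" if "f = (a, b) \<or> f = (b, a)" for f
    using that unfolding econn_def by blast
  have "(a, b) \<in> S \<or> (b, a) \<in> S" using walk(2) p e by auto
  then show False
  proof
    assume "(a, b) \<in> S"
    then show False using S econn_sym[OF ba[of "(a, b)"]] unfolding eforest_def by auto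
  next
    assume "(b, a) \<in> S"
    then show False using S ba[of "(b, a)"] unfolding eforest_def by auto
  qed
qed

lemma utree_of_eforest:
  assumes V: "finite V" "V \<noteq> {}" and S: "S \<subseteq> V \<times> V" "eforest S" and conn: "V \<times> V \<subseteq> econn S"
  shows "utree \<lparr>pverts = V, parcs = S \<union> S\<inverse>\<rparr>" (is "utree ?H")
proof -
  have finS: "finite S" using V(1) S(1) finite_subset by blast
  have "(x, x) \<notin> S" for x
  proof
    assume "(x, x) \<in> S"
    with S(2) have "(x, x) \<notin> econn (S - {(x, x)})" unfolding eforest_def by (rule bspec)
    then show False by simp
  qed
  then have H: "pair_graph ?H"
    using V(1) S(1) finS by unfold_locales (auto simp: symmetric_def sym_def)
  have reach: "(u, v) \<in> rtrancl_on V (S \<union> S\<inverse>)" if "u \<in> V" "v \<in> V" for u v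
  proof -
    have "(u, v) \<in> econn S" using that by (intro subsetD[OF conn]) simp
    then have "(u, v) \<in> (S \<union> S\<inverse>)\<^sup>*" unfolding econn_def .
    then show ?thesis
    proof (induction rule: rtrancl_induct)
      case (step y z)
      have "z \<in> V" using step.hyps(2) S(1) by auto
      with step.IH step.hyps(2) show ?case by (rule rtrancl_on_into_rtrancl_on)
    qed (use that in auto)
  qed
  have "parcs (mk_symmetric (with_proj ?H)) = S \<union> S\<inverse>" and "pverts (mk_symmetric (with_proj ?H)) = V"
    unfolding mk_symmetric_def by auto
  then have "Digraph_Component.connected (with_proj ?H)"
    unfolding connected_def strongly_connected_def reachable_def using reach V(2) by simp
  then show ?thesis unfolding utree_def using H eforest_no_ucycle[OF S(2), of ?H] by auto
qed

lemma tau_ge: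
  assumes G: "pair_graph G" and V: "pverts G \<noteq> {}" "card (pverts G) \<noteq> 1"
    and F: "forest_tuple E k F" "\<And>i. i < k \<Longrightarrow> pverts G \<times> pverts G \<subseteq> econn (F i)"
    and E: "E \<inter> E\<inverse> = {}" "E \<union> E\<inverse> = parcs G"
  shows "k \<le> tau G"
proof -
  interpret pair_graph G by fact
  let ?V = "pverts G"
  have fin: "finite ?V" "finite (parcs G)" by auto
  define H where "H i = \<lparr>pverts = ?V, parcs = F i \<union> (F i)\<inverse>\<rparr>" for i
  have FE: "F i \<subseteq> E" "eforest (F i)" if "i < k" for i using F(1) that unfolding forest_tuple_def by auto
  have FV: "F i \<subseteq> ?V \<times> ?V" if "i < k" for i using FE(1)[OF that] E(2) wellformed' by auto
  have tree: "utree (H i)" if "i < k" for i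
    unfolding H_def using utree_of_eforest[OF fin(1) V(1) FV[OF that] FE(2)[OF that] F(2)[OF that]] .
  have wf: "wf_digraph (with_proj G)" by unfold_locales
  have span: "spanning_utree (H i) G" if "i < k" for i
  proof -
    have "pair_graph (H i)" using tree[OF that] unfolding utree_def by simp
    then have "pair_wf_digraph (H i)" unfolding pair_graph_def pair_digraph_def pair_fin_digraph_def by simp
    then have "wf_digraph (with_proj (H i))" unfolding wf_digraph_wp_iff .
    moreover have "parcs (H i) \<subseteq> parcs G" "pverts (H i) = ?V" using FE(1)[OF that] E(2) unfolding H_def by auto
    ultimately show ?thesis using tree[OF that] wf
      unfolding spanning_utree_def spanning_def subgraph_def compatible_def by auto
  qed
  have disj: "parcs (H i) \<inter> parcs (H j) = {}" if "i < k" "j < k" "i \<noteq> j" for i j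
  proof -
    have "F i \<inter> F j = {}" using F(1) that unfolding forest_tuple_def by auto
    then show ?thesis using FE(1)[OF that(1)] FE(1)[OF that(2)] E(1) unfolding H_def by auto
  qed
  \<comment> \<open>A packing is a set, so equal trees would be counted once. With at least two
    vertices every tree has an arc, and disjointness then makes \<open>H\<close> injective.\<close>
  have ne: "parcs (H i) \<noteq> {}" if "i < k" for i
  proof
    assume "parcs (H i) = {}"
    then have "econn (F i) = Id" unfolding H_def econn_def by simp
    then have "\<And>x y. x \<in> ?V \<Longrightarrow> y \<in> ?V \<Longrightarrow> x = y" using F(2)[OF that] by auto
    then have "card ?V \<le> 1" using card_le_Suc0_iff_eq[OF fin(1)] by auto
    then show False using V fin(1) by (simp add: le_Suc_eq)
  qed
  have "inj_on H {..<k}"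
  proof (rule inj_onI)
    fix i j assume "i \<in> {..<k}" "j \<in> {..<k}" "H i = H j"
    then show "i = j" using disj[of i j] ne[of i] by (cases "i = j") auto
  qed
  then have card: "card (H ` {..<k}) = k" by (simp add: card_image)
  have "pairwise (\<lambda>H K. parcs H \<inter> parcs K = {}) (H ` {..<k})"
    using disj by (auto simp: pairwise_def)
  then have "tree_packing (H ` {..<k}) G" unfolding tree_packing_def using span by auto
  then have "k \<in> {card F | F. tree_packing F G}" using card by (metis (mono_tags, lifting) mem_Collect_eq)
  \<comment> \<open>\<open>Max\<close> needs a finite set: every packing consists of subgraphs with
    vertex set \<open>?V\<close>, of which there are finitely many.\<close>
  moreover have "finite {card F | F. tree_packing F G}"
  proof (rule finite_subset)
    let ?K = "(\<lambda>A. \<lparr>pverts = ?V, parcs = A\<rparr>) ` Pow (parcs G)"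
    have finK: "finite ?K" using fin(2) by simp
    have "H \<in> ?K" if "spanning_utree H G" for H
    proof -
      have "pverts H = ?V" "parcs H \<subseteq> parcs G"
        using that unfolding spanning_utree_def spanning_def subgraph_def by auto
      then show ?thesis by (intro image_eqI[of _ _ "parcs H"]) auto
    qed
    then have "F \<subseteq> ?K" if "tree_packing F G" for F using that unfolding tree_packing_def by auto
    then show "{card F | F. tree_packing F G} \<subseteq> {..card ?K}" using card_mono[OF finK] by blast
  qed simp
  ultimately show ?thesis unfolding tau_def by (rule Max_ge[rotated])
qed

section \<open>The eigenvalue bound\<close>

lemma out_degree_eq: "out_degree (with_proj G) v = card (parcs G `` {v})"
proof -
  have "out_arcs (with_proj G) v = Pair v ` (parcs G `` {v})" by auto
  then show ?thesis unfolding out_degree_def by (simp add: card_image inj_on_def)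
qed

lemma sum_indicator_edges:
  fixes E :: "('a \<times> 'a) set"
  assumes "finite V" "E \<subseteq> V \<times> V"
  shows "(\<Sum>u\<in>V. \<Sum>v\<in>V. (if (u, v) \<in> E then 1 else 0) * indicator A u * indicator B v) = real (card (E \<inter> A \<times> B))"
proof -
  define S where "S = E \<inter> A \<times> B"
  have "(\<Sum>u\<in>V. \<Sum>v\<in>V. (if (u, v) \<in> E then 1 else 0) * indicator A u * indicator B v)
      = (\<Sum>p\<in>V \<times> V. if p \<in> S then 1 else 0 :: real)"
    unfolding sum.cartesian_product S_def by (intro sum.cong) (auto simp: indicator_def)
  also have "\<dots> = real (card (V \<times> V \<inter> S))"
    using assms(1) by (simp add: sum.If_cases)
  also have "V \<times> V \<inter> S = S" using assms(2) unfolding S_def by auto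
  finally show ?thesis unfolding S_def .
qed

lemma sum_degrees:
  assumes "finite E" "finite X"
  shows "(\<Sum>x\<in>X. card (E `` {x})) = card (E \<inter> X \<times> X) + bdry E X"
proof -
  have "(\<Sum>x\<in>X. card (E `` {x})) = card (SIGMA x:X. E `` {x})"
    using assms by (simp add: card_SigmaI finite_Image)
  also have "(SIGMA x:X. E `` {x}) = (E \<inter> X \<times> X) \<union> (E \<inter> X \<times> - X)" by auto
  also have "card \<dots> = card (E \<inter> X \<times> X) + bdry E X"
    unfolding bdry_def using assms by (intro card_Un_disjoint) auto
  finally show ?thesis .
qed

lemma lambda2_ge:
  fixes G :: "'a pair_pre_digraph" and a :: real
  assumes G: "pair_graph G" and a: "-1 \<le> a"
    and deg: "\<And>v. v \<in> pverts G \<Longrightarrow> \<delta> \<le> card (parcs G `` {v})"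
    and XY: "X \<subseteq> pverts G" "Y \<subseteq> pverts G" "X \<inter> Y = {}"
    and bd: "bdry (parcs G) X + card (parcs G \<inter> X \<times> Y) \<le> K" "bdry (parcs G) Y + card (parcs G \<inter> X \<times> Y) \<le> K"
    and N: "0 < N" "N \<le> card X" "N \<le> card Y"
  shows "(a + 1) * real \<delta> - real K / real N \<le> lambda 2 G a"
proof -
  interpret pair_graph G by fact
  let ?V = "pverts G" and ?E = "parcs G"
  define \<mu> where "\<mu> = (a + 1) * real \<delta> - real K / real N"
  have fin: "finite ?V" "finite ?E" by auto
  have EV: "?E \<subseteq> ?V \<times> ?V" using wellformed' by auto
  have finXY: "finite X" "finite Y" by (rule finite_subset[OF XY(1) fin(1)], rule finite_subset[OF XY(2) fin(1)])
  define vs where "vs = vert_list G"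
  have "\<exists>vs. distinct vs \<and> set vs = ?V" using finite_distinct_list[OF fin(1)] by auto
  then have vs: "distinct vs" "set vs = ?V"
    unfolding vs_def vert_list_def by (metis (mono_tags, lifting) someI_ex)+
  define n where "n = length vs"
  have n: "n = card ?V" unfolding n_def using vs distinct_card by metis
  have sum_nth: "(\<Sum>i<n. h (vs ! i)) = (\<Sum>v\<in>?V. h v)" for h :: "'a \<Rightarrow> real"
    using sum.reindex_bij_betw[OF bij_betw_nth[OF vs(1) refl refl], of h] vs(2) unfolding n_def by simp
  define M where "M = aDA_mat G a"
  have M: "M \<in> carrier_mat n n" unfolding M_def aDA_mat_def deg_mat_def adj_mat_def vs_def[symmetric] n_def by simp
  define d where "d v = real (card (?E `` {v}))" for v
  define e where "e u v = (if (u, v) \<in> ?E then 1 else 0 :: real)" for u v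
  have Mij: "M $$ (i, j) = a * (if i = j then d (vs ! i) else 0) + e (vs ! i) (vs ! j)" if "i < n" "j < n" for i j
    using that unfolding M_def aDA_mat_def deg_mat_def adj_mat_def vs_def[symmetric] n_def d_def e_def out_degree_eq by simp
  have sym: "transpose_mat M = M"
    using M Mij arcs_symmetric by (intro eq_matI) (auto simp: e_def)
  define w where "w f = vec n (\<lambda>i. f (vs ! i))" for f :: "'a \<Rightarrow> real"
  have norm: "w f \<bullet> w f = (\<Sum>v\<in>?V. (f v)\<^sup>2)" for f
    unfolding w_def scalar_prod_def using sum_nth[of "\<lambda>v. (f v)\<^sup>2"] by (simp add: atLeast0LessThan power2_eq_square)
  have quad: "w f \<bullet> (M *\<^sub>v w f) = a * (\<Sum>v\<in>?V. d v * (f v)\<^sup>2) + (\<Sum>u\<in>?V. \<Sum>v\<in>?V. e u v * f u * f v)" for f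
  proof -
    have "(M *\<^sub>v w f) $ i = a * d (vs ! i) * f (vs ! i) + (\<Sum>v\<in>?V. e (vs ! i) v * f v)" if i: "i < n" for i
    proof -
      have "(M *\<^sub>v w f) $ i = (\<Sum>j<n. M $$ (i, j) * f (vs ! j))"
        using i M unfolding w_def by (simp add: scalar_prod_def atLeast0LessThan)
      also have "\<dots> = (\<Sum>j<n. (if j = i then a * d (vs ! i) * f (vs ! i) else 0) + e (vs ! i) (vs ! j) * f (vs ! j))"
        using i by (intro sum.cong) (auto simp: Mij algebra_simps)
      also have "\<dots> = a * d (vs ! i) * f (vs ! i) + (\<Sum>j<n. e (vs ! i) (vs ! j) * f (vs ! j))"
        using i by (simp add: sum.distrib)
      finally show ?thesis using sum_nth[of "\<lambda>v. e (vs ! i) v * f v"] by simp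
    qed
    then have "w f \<bullet> (M *\<^sub>v w f) = (\<Sum>i<n. f (vs ! i) * (a * d (vs ! i) * f (vs ! i) + (\<Sum>v\<in>?V. e (vs ! i) v * f v)))"
      unfolding scalar_prod_def using M by (simp add: atLeast0LessThan) (simp add: w_def)
    also have "\<dots> = (\<Sum>u\<in>?V. f u * (a * d u * f u + (\<Sum>v\<in>?V. e u v * f v)))"
      using sum_nth[of "\<lambda>u. f u * (a * d u * f u + (\<Sum>v\<in>?V. e u v * f v))"] .
    also have "\<dots> = a * (\<Sum>v\<in>?V. d v * (f v)\<^sup>2) + (\<Sum>u\<in>?V. \<Sum>v\<in>?V. e u v * f u * f v)"
      by (simp add: sum.distrib sum_distrib_left distrib_left power2_eq_square algebra_simps)
    finally show ?thesis .
  qed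
  have sum_ind: "(\<Sum>v\<in>?V. h v * indicator A v) = (\<Sum>v\<in>A. h v)" if "A \<subseteq> ?V" for A and h :: "'a \<Rightarrow> real"
    using that fin(1) by (simp add: sum.inter_restrict[symmetric] indicator_def of_bool_def if_distrib Int_absorb1 cong: if_cong)
  have vol: "(\<Sum>v\<in>A. d v) = real (card (?E \<inter> A \<times> A)) + real (bdry ?E A)" if "A \<subseteq> ?V" for A
    using sum_degrees[OF fin(2), of A] that fin(1) finite_subset unfolding d_def by (metis of_nat_add of_nat_sum)
  have vol_ge: "real \<delta> * real (card A) \<le> (\<Sum>v\<in>A. d v)" if "A \<subseteq> ?V" for A
    using sum_bounded_below[of A "real \<delta>" d] that deg unfolding d_def by (auto simp: mult.commute subset_iff)
  let ?x = "w (indicator X)" and ?y = "w (indicator Y)"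
  have key: "\<mu> * (z \<bullet> z) \<le> z \<bullet> (M *\<^sub>v z)" if z: "z = \<alpha> \<cdot>\<^sub>v ?x + \<beta> \<cdot>\<^sub>v ?y" for \<alpha> \<beta> z
  proof -
    define f where "f v = \<alpha> * indicator X v + \<beta> * indicator Y v" for v
    have zf: "z = w f" unfolding z w_def f_def by (intro eq_vecI) auto
    have f2: "(f v)\<^sup>2 = \<alpha>\<^sup>2 * indicator X v + \<beta>\<^sup>2 * indicator Y v" for v
      using XY(3) unfolding f_def by (auto simp: indicator_def)
    have zz: "z \<bullet> z = \<alpha>\<^sup>2 * card X + \<beta>\<^sup>2 * card Y"
      unfolding zf norm f2 using sum_ind[OF XY(1), of "\<lambda>_. \<alpha>\<^sup>2"] sum_ind[OF XY(2), of "\<lambda>_. \<beta>\<^sup>2"]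
      by (simp add: sum.distrib mult.commute Int_absorb1[OF XY(1)] Int_absorb1[OF XY(2)])
    have deg_part: "(\<Sum>v\<in>?V. d v * (f v)\<^sup>2) = \<alpha>\<^sup>2 * (\<Sum>v\<in>X. d v) + \<beta>\<^sup>2 * (\<Sum>v\<in>Y. d v)"
    proof -
      have "(\<Sum>v\<in>?V. d v * (f v)\<^sup>2) = (\<Sum>v\<in>?V. (\<alpha>\<^sup>2 * d v) * indicator X v) + (\<Sum>v\<in>?V. (\<beta>\<^sup>2 * d v) * indicator Y v)"
        unfolding f2 by (simp add: sum.distrib distrib_left mult.assoc mult.left_commute)
      then show ?thesis using sum_ind XY by (simp add: sum_distrib_left)
    qed
    have comm: "card (?E \<inter> Y \<times> X) = card (?E \<inter> X \<times> Y)"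
    proof -
      have "?E \<inter> Y \<times> X = (?E \<inter> X \<times> Y)\<inverse>" using arcs_symmetric by auto
      then show ?thesis by (simp add: card_inverse)
    qed
    have adj_part: "(\<Sum>u\<in>?V. \<Sum>v\<in>?V. e u v * f u * f v) =
        \<alpha>\<^sup>2 * card (?E \<inter> X \<times> X) + \<beta>\<^sup>2 * card (?E \<inter> Y \<times> Y) + 2 * \<alpha> * \<beta> * card (?E \<inter> X \<times> Y)"
    proof -
      let ?S = "\<lambda>A B. (\<Sum>u\<in>?V. \<Sum>v\<in>?V. e u v * indicator A u * indicator B v)"
      have S: "?S A B = card (?E \<inter> A \<times> B)" for A B
        unfolding e_def by (rule sum_indicator_edges[OF fin(1) EV])
      have "(\<Sum>u\<in>?V. \<Sum>v\<in>?V. e u v * f u * f v) =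
          \<alpha>\<^sup>2 * ?S X X + \<alpha> * \<beta> * ?S X Y + \<alpha> * \<beta> * ?S Y X + \<beta>\<^sup>2 * ?S Y Y"
        unfolding f_def sum_distrib_left sum.distrib[symmetric]
        by (intro sum.cong refl) (simp add: power2_eq_square algebra_simps)
      then show ?thesis unfolding S comm by simp
    qed
    have zMz: "z \<bullet> (M *\<^sub>v z) = \<alpha>\<^sup>2 * ((a + 1) * (\<Sum>v\<in>X. d v) - bdry ?E X) + \<beta>\<^sup>2 * ((a + 1) * (\<Sum>v\<in>Y. d v) - bdry ?E Y)
        + 2 * \<alpha> * \<beta> * card (?E \<inter> X \<times> Y)"
      unfolding zf quad deg_part adj_part using vol[OF XY(1)] vol[OF XY(2)] by (simp add: algebra_simps)
    have part: "\<mu> * card A \<le> (a + 1) * (\<Sum>v\<in>A. d v) - (bdry ?E A + card (?E \<inter> X \<times> Y))"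
      if A: "A \<subseteq> ?V" "bdry ?E A + card (?E \<inter> X \<times> Y) \<le> K" "N \<le> card A" for A
    proof -
      have "(a + 1) * (real \<delta> * real (card A)) \<le> (a + 1) * (\<Sum>v\<in>A. d v)"
        using vol_ge[OF A(1)] a by (intro mult_left_mono) auto
      \<comment> \<open>The lower bound \<open>N\<close> on the part enters here: it turns the
        constant \<open>K\<close> into a multiple of \<open>card A\<close>, which is what
        \<open>z \<bullet> z\<close> offers for comparison.\<close>
      moreover have "real K * 1 \<le> real K * (real (card A) / real N)"
        using A(3) N(1) by (intro mult_left_mono) auto
      moreover have "real (bdry ?E A) + real (card (?E \<inter> X \<times> Y)) \<le> real K" using A(2) by linarith
      ultimately show ?thesis unfolding \<mu>_def by (simp add: algebra_simps)
    qed
    have "- (\<alpha>\<^sup>2 + \<beta>\<^sup>2) \<le> 2 * \<alpha> * \<beta>" using zero_le_power2[of "\<alpha> + \<beta>"] by (simp add: power2_sum)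
    then have "- (\<alpha>\<^sup>2 + \<beta>\<^sup>2) * card (?E \<inter> X \<times> Y) \<le> 2 * \<alpha> * \<beta> * card (?E \<inter> X \<times> Y)"
      by (intro mult_right_mono) auto
    moreover have "\<alpha>\<^sup>2 * (\<mu> * card X) \<le> \<alpha>\<^sup>2 * ((a + 1) * (\<Sum>v\<in>X. d v) - (bdry ?E X + card (?E \<inter> X \<times> Y)))"
      using part[OF XY(1) bd(1) N(2)] by (intro mult_left_mono) auto
    moreover have "\<beta>\<^sup>2 * (\<mu> * card Y) \<le> \<beta>\<^sup>2 * ((a + 1) * (\<Sum>v\<in>Y. d v) - (bdry ?E Y + card (?E \<inter> X \<times> Y)))"
      using part[OF XY(2) bd(2) N(3)] by (intro mult_left_mono) auto
    ultimately show ?thesis unfolding zz zMz by (simp add: algebra_simps)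
  qed
  have carr: "?x \<in> carrier_vec n" "?y \<in> carrier_vec n" unfolding w_def by auto
  have ne: "X \<noteq> {}" "Y \<noteq> {}" using N finXY by auto
  have indep: "\<alpha> = 0 \<and> \<beta> = 0" if z: "\<alpha> \<cdot>\<^sub>v ?x + \<beta> \<cdot>\<^sub>v ?y = 0\<^sub>v n" for \<alpha> \<beta>
  proof -
    have *: "\<alpha> * indicator X v + \<beta> * indicator Y v = 0" if v: "v \<in> ?V" for v
    proof -
      obtain i where i: "i < n" "vs ! i = v"
        using v unfolding n_def vs(2)[symmetric] in_set_conv_nth by blast
      have "(\<alpha> \<cdot>\<^sub>v ?x + \<beta> \<cdot>\<^sub>v ?y) $ i = 0" unfolding z using i by simp
      then show ?thesis using i unfolding w_def by simp
    qed
    obtain x y where xy: "x \<in> X" "y \<in> Y" using ne by auto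
    then have "x \<notin> Y" "y \<notin> X" "x \<in> ?V" "y \<in> ?V" using XY by auto
    then show ?thesis using *[of x] *[of y] xy by simp
  qed
  have "card X + card Y \<le> n"
    using card_mono[OF fin(1), of "X \<union> Y"] card_Un_disjoint[OF finXY XY(3)] XY n by auto
  then have "2 \<le> n" using N by linarith
  from second_eigenvalue_ge[OF M sym this carr indep key]
  show ?thesis unfolding lambda_def M_def \<mu>_def by simp
qed

theorem theorem1p7:
  fixes G :: "'a pair_pre_digraph" and g k n \<delta> :: nat and a :: real
  assumes "g \<ge> 3" and "k \<ge> 2" and "a \<ge> -1"
    and "pair_graph G" and "card (pverts G) = n"
    and "min_degree G = \<delta>" and "\<delta> \<ge> 2 * k" and "girth G = enat g"
    and "lambda 2 G a < (a + 1) * real \<delta> - (2 * real k - 1) / real (n1_star \<delta> g)"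
  shows "tau G \<ge> k"
proof (rule ccontr)
  assume not_ge: "\<not> ?thesis"
  interpret pair_graph G by fact
  let ?V = "pverts G" and ?E = "parcs G"
  have fin: "finite ?V" "finite ?E" by auto
  have sym: "sym ?E" and irr: "irrefl ?E" using arcs_symmetric no_loops' by (auto simp: sym_def irrefl_def)
  have EV: "?E \<subseteq> ?V \<times> ?V" using wellformed' by auto
  \<comment> \<open>A finite girth supplies a cycle and thereby a vertex.\<close>
  have "\<exists>p. ucycle G p"
  proof (rule ccontr)
    assume "\<not> ?thesis"
    then have "girth G = \<infinity>" unfolding girth_def by (auto simp: top_enat_def[symmetric])
    then show False using assms(8) by simp
  qed
  then obtain u where u: "u \<in> ?V" unfolding ucycle_def cycle_def awalk_def by auto
  then have Vne: "?V \<noteq> {}" by auto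
  have deg: "\<delta> \<le> card (?E `` {v})" if "v \<in> ?V" for v
    using assms(6) fin that unfolding min_degree_def out_degree_eq by (metis Min_le finite_imageI imageI)
  have "?E `` {u} \<noteq> {}" using deg[OF u] assms(2,7) by auto
  then obtain v where v: "(u, v) \<in> ?E" by auto
  have card1: "card ?V \<noteq> 1"
    using v no_loops'[OF v] in_arcsD1[OF v] in_arcsD2[OF v] by (metis card_1_singletonE singletonD)
  \<comment> \<open>An injective numbering selects one orientation of every edge, so that
    cardinalities of sets of pairs count undirected edges.\<close>
  obtain h :: "'a \<Rightarrow> nat" where h: "inj_on h ?V"
    using finite_imp_inj_to_nat_seg[OF fin(1)] by auto
  define E0 where "E0 = {(x, y) \<in> ?E. h x < h y}"
  have E0: "E0 \<inter> E0\<inverse> = {}" "E0 \<union> E0\<inverse> = ?E"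
  proof -
    have "h x \<noteq> h y" if "(x, y) \<in> ?E" for x y
      using h that no_loops'[OF that] wellformed'[OF that] by (auto dest: inj_onD)
    then show "E0 \<union> E0\<inverse> = ?E" unfolding E0_def using arcs_symmetric by (auto simp: neq_iff)
    show "E0 \<inter> E0\<inverse> = {}" unfolding E0_def by auto
  qed
  have finE0: "finite E0" and E0V: "E0 \<subseteq> ?V \<times> ?V" using E0(2) fin(2) EV by (auto intro: finite_subset)
  have "\<not> (\<exists>F. forest_tuple E0 k F \<and> (\<forall>i<k. ?V \<times> ?V \<subseteq> econn (F i)))"
    using tau_ge[OF assms(4) Vne card1 _ _ E0] not_ge by blast
  then obtain R where R: "R \<subseteq> E0" "card (E0 - R) < k * (card (?V // econn R) - 1)"
    using tree_packing_or_partition[OF fin(1) Vne E0V, of k] by blast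
  let ?P = "?V // econn R"
  have finP: "finite ?P" "?P \<noteq> {}" using fin(1) u unfolding quotient_def by auto
  have disj: "X \<inter> Y = {}" if "X \<in> ?P" "Y \<in> ?P" "X \<noteq> Y" for X Y
    using quotient_disj[OF equiv_econn[of R], of X Y] that by (metis quotientE quotientI UNIV_I)
  have "2 * card (E0 - R) < 2 * (k * (card ?P - 1))" using R(2) by simp
  then have few: "(\<Sum>X\<in>?P. bdry ?E X) < 2 * k * (card ?P - 1)"
    using sum_bdry_quotient_le[OF fin(2,1) finE0 E0(2)[symmetric] EV, of R] by simp
  have "x \<in> \<Union>?P" if "x \<in> ?V" for x
    using quotientI[OF that, of "econn R"] by (intro UnionI[of "econn R `` {x}"]) auto
  then have cover: "?E \<subseteq> \<Union>?P \<times> \<Union>?P" using EV by auto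
  obtain X Y where XY: "X \<in> ?P" "Y \<in> ?P" "X \<noteq> Y"
    and bd: "bdry ?E X + card (?E \<inter> X \<times> Y) < 2 * k" "bdry ?E Y + card (?E \<inter> X \<times> Y) < 2 * k"
  proof (rule two_parts[OF fin(2) finP _ cover few])
    fix X Y assume "X \<in> ?P" "Y \<in> ?P" "X \<noteq> Y"
    then show "X \<inter> Y = {}" by (rule disj)
  qed (rule that)
  have nsc: "no_short_cycle ?E g" using girth_imp_no_short_cycle[OF assms(4), of g] assms(8) by simp
  have part: "Z \<subseteq> ?V" "n1_star \<delta> g \<le> card Z" if Z: "Z \<in> ?P" "bdry ?E Z < 2 * k" for Z
  proof -
    obtain z where z: "z \<in> ?V" "Z = econn R `` {z}" using Z(1) by (rule quotientE)
    \<comment> \<open>The relation \<open>econn R\<close> lives on the whole type, but its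
      nontrivial steps stay in \<open>?V\<close>, so classes of vertices contain vertices
      only.\<close>
    have "w \<in> ?V" if "(z, w) \<in> (R \<union> R\<inverse>)\<^sup>*" for w
      using that by (induction rule: rtrancl_induct) (use z(1) R(1) E0V in auto)
    then show ZV: "Z \<subseteq> ?V" unfolding z(2) econn_def by auto
    have finZ: "finite Z" using ZV fin(1) by (rule finite_subset)
    have "Z \<noteq> {}" using econn_refl[of z R] unfolding z(2) by blast
    then show "n1_star \<delta> g \<le> card Z"
      by (rule small_boundary_imp_large[OF fin(2) finZ sym irr nsc assms(1)])
        (use deg ZV Z(2) assms(2,7) bdry_eq_sum[OF fin(2) finZ] in auto)
  qed
  have "(a + 1) * real \<delta> - real (2 * k - 1) / real (n1_star \<delta> g) \<le> lambda 2 G a"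
  proof (rule lambda2_ge[OF assms(4,3) deg])
    show "X \<inter> Y = {}" using disj XY by blast
  qed (use part XY bd n1_star_pos in auto)
  then show False using assms(2,9) by (simp add: of_nat_diff)
qed

end
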